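(* Let $\alpha>0$ and let $X_\alpha=\{X_\alpha(t),t\in\mathbb R^+\}$ be an $\alpha$-permanental process, with continuous sample paths, with kernel $u(s,t)$ and sigma function $\sigma(s,t)$. Suppose there is an increasing function $\varphi$ such that $\sigma(s,t)\le\varphi(|t-s|)$ for all $0\le s,t<\infty$ and $$\int_0^{1/2}\frac{\varphi(u)}{u(\log 1/u)^{1/2}}\,du<\infty.$$ Assume furthermore that $t\mapsto u(t,t)$ is regularly varying at infinity with positive index and $\varphi^2(t)=O(u(t,t))$ as $t\to\infty$. Then $$\limsup_{t\to\infty}\frac{X_\alpha(t)}{u(t,t)\log\log t}\le1\qquad a.s.$$
   Context: For $\alpha>0$, a random vector $(X_1,\dots,X_n)$ with nonnegative components is $\alpha$-permanental with kernel $U$ (a real $n\times n$ matrix) if $E\big(e^{-\sum_{i=1}^n s_iX_i}\big)=|I+US|^{-\alpha}$ for every diagonal matrix $S$ with positive diagonal entries $s_1,\dots,s_n$, where $|\cdot|$ denotes the determinant. A stochastic process $\{X_\alpha(t),t\in\mathcal T\}$ is an $\alpha$-permanental process with kernel $\{u(s,t),s,t\in\mathcal T\}$ if for all $t_1,\dots,t_n\in\mathcal T$ the vector $(X_\alpha(t_1),\dots,X_\alpha(t_n))$ is $\alpha$-permanental with kernel $\{u(t_i,t_j)\}_{i,j=1}^n$. Its sigma function is $\sigma(s,t)=\big(u(s,s)+u(t,t)-2(u(s,t)u(t,s))^{1/2}\big)^{1/2}$ (all quantities under the square roots are known to be nonnegative). Standing assumption on kernels: $\sup_{t\le\delta}u(t,t)>0$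 for all $\delta>0$. $\mathbb R^+=[0,\infty)$. *)

theory Defs
  imports
    "HOL-Probability.Probability"
    "HOL-Library.Landau_Symbols"
    "Jordan_Normal_Form.Determinant"
begin

text \<open>
  The determinant identity needs no separate positivity condition for the real power: the expectation
  is positive, so (as \<open>0 powr a = 0\<close>) the determinant has no zero over the connected set of
  positive diagonal matrices, and it tends to \<open>1\<close> as \<open>S\<close> tends to \<open>0\<close>.
\<close>

definition permanental_vector ::
    "'a measure \<Rightarrow> real \<Rightarrow> nat \<Rightarrow> real mat \<Rightarrow> (nat \<Rightarrow> 'a \<Rightarrow> real) \<Rightarrow> bool" where
  "permanental_vector M \<alpha> n U Y \<longleftrightarrow>
     U \<in> carrier_mat n n \<and>
     (\<forall>i<n. Y i \<in> borel_measurable M \<and> (AE \<omega> in M. 0 \<le> Y i \<omega>)) \<and>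
     (\<forall>s :: nat \<Rightarrow> real. (\<forall>i<n. 0 < s i) \<longrightarrow>
        (\<integral>\<omega>. exp (- (\<Sum>i<n. s i * Y i \<omega>)) \<partial>M)
          = Determinant.det (1\<^sub>m n + U * mat_diag n s) powr (- \<alpha>))"

definition permanental_process ::
    "'a measure \<Rightarrow> real \<Rightarrow> 't set \<Rightarrow> ('t \<Rightarrow> 't \<Rightarrow> real) \<Rightarrow> ('t \<Rightarrow> 'a \<Rightarrow> real) \<Rightarrow> bool" where
  "permanental_process M \<alpha> T u X \<longleftrightarrow>
     (\<forall>n. \<forall>t :: nat \<Rightarrow> 't. (\<forall>i<n. t i \<in> T) \<longrightarrow>
        permanental_vector M \<alpha> n (Matrix.mat n n (\<lambda>(i, j). u (t i) (t j))) (\<lambda>i. X (t i)))"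

definition sigma_fun :: "('t \<Rightarrow> 't \<Rightarrow> real) \<Rightarrow> 't \<Rightarrow> 't \<Rightarrow> real" where
  "sigma_fun u s t = sqrt (u s s + u t t - 2 * sqrt (u s t * u t s))"

text \<open>
  Karamata's definition. As usual, a regularly varying function is required to be measurable and
  positive on some half-line.
\<close>

definition regularly_varying :: "(real \<Rightarrow> real) \<Rightarrow> real \<Rightarrow> bool" where
  "regularly_varying f \<rho> \<longleftrightarrow>
     (\<exists>a. (\<forall>t\<ge>a. 0 < f t) \<and> f \<in> borel_measurable (restrict_space borel {a..})) \<and>
     (\<forall>c>0. ((\<lambda>t. f (c * t) / f t) \<longlongrightarrow> c powr \<rho>) at_top)"

end

theory Submission
  imports Defs
begin

text \<open>
  Write \<open>U t = u t t\<close> and let \<open>Z t\<close> be the square root of \<open>X t\<close>. Each \<open>X t\<close> is gamma distributed with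
  scale \<open>U t\<close>, so \<open>X t > y U t\<close> has a probability of order at most \<open>exp (- p y)\<close> for every \<open>p < 1\<close>. Along
  a sequence of times that grows geometrically, where \<open>ln (ln t)\<close> is about \<open>ln n\<close> at the \<open>n\<close>-th time, the
  Borel-Cantelli lemma gives the asserted bound with any constant above \<open>1\<close>
  (\<open>AE_grid_margins\<close>). What remains is to show that between these times the path does not move much.

  The key is that \<open>Z\<close> has subgaussian increments: the probability of \<open>|Z s - Z t| > x \<sigma>(s,t)\<close> is at most
  a constant times \<open>exp (- x\<^sup>2 / 72)\<close> (\<open>increment_tail\<close>). If \<open>\<alpha>\<close> is half an integer, \<open>X\<close> behaves in each
  pair of times like half the squared norm of a Gaussian vector process and this is classical; for other
  \<open>\<alpha>\<close> it has to be extracted from the Laplace transform of the pair alone. That transform is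
  \<open>(1 + a x + b y + d x y) powr (- \<alpha>)\<close>. For fixed \<open>y > 0\<close> it is a gamma transform in \<open>x\<close>, so it continues to
  negative \<open>x\<close> up to its pole (\<open>gamma_laplace_extends\<close>), which for large \<open>y\<close> can lie much further
  out than for \<open>X s\<close> alone. On the other hand \<open>(Z s - Z t)\<^sup>2\<close> is a supremum of linear functions of \<open>X s\<close> and \<open>X t\<close>, and
  a geometric grid of these functions suffices. Summing their exponential moments gives a convergent
  geometric series (\<open>increment_mgf\<close>).

  With such increments the rest is chaining, on two ranges of scales. Inside unit intervals the
  integral condition on \<open>\<phi>\<close> yields oscillations of order \<open>sqrt (ln t)\<close> (\<open>AE_local_oscillation\<close>),
  negligible since \<open>U\<close> grows like a power. For scales \<open>2 ^ r\<close> with \<open>r \<ge> 0\<close>, regular variation with a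
  positive index together with \<open>\<phi>\<^sup>2 = O(U)\<close> shows that \<open>\<phi> (2 ^ r)\<close> is at most a constant times
  \<open>q ^ (n - r) sqrt (U (2 ^ n))\<close> with \<open>q < 1\<close> (\<open>regularly_varying_dominates_dyadic\<close>). Hence chaining over a
  block of length \<open>2 ^ (n - m)\<close> costs a multiple of \<open>sqrt (U (2 ^ n) * ln n)\<close> that tends to \<open>0\<close> as \<open>m\<close> grows.
  Since \<open>|sqrt (U s) - sqrt (U t)| \<le> \<sigma>(s,t)\<close>, the normalisation varies equally little within a block.
  Letting the blocks become finer gives the constant \<open>1\<close>.
\<close>

section \<open>Gamma Laplace transforms beyond the origin\<close>

text \<open>
  The integrals below are known only for positive Laplace parameters, so the two expansions agree
  on one side of the origin only. That is enough: the first coefficient in which they differ is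
  the right-hand limit at \<open>0\<close> of the difference divided by a power of \<open>x\<close>.
\<close>

lemma powser_coeffs_eqI:
  fixes a b :: "nat \<Rightarrow> real"
  assumes s: "0 < s"
    and a: "\<And>x. \<bar>x\<bar> < s \<Longrightarrow> summable (\<lambda>k. a k * x ^ k)"
    and b: "\<And>x. \<bar>x\<bar> < s \<Longrightarrow> summable (\<lambda>k. b k * x ^ k)"
    and eq: "\<And>x. 0 < x \<Longrightarrow> x < s \<Longrightarrow> (\<Sum>k. a k * x ^ k) = (\<Sum>k. b k * x ^ k)"
  shows "a = b"
proof (rule ccontr)
  assume "a \<noteq> b"
  define d where "d k = a k - b k" for k
  have ex: "\<exists>k. d k \<noteq> 0"
    using \<open>a \<noteq> b\<close> by (auto simp: d_def fun_eq_iff)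
  define n where "n = (LEAST k. d k \<noteq> 0)"
  have dn: "d n \<noteq> 0" and lt: "\<And>k. k < n \<Longrightarrow> d k = 0"
    unfolding n_def using LeastI_ex[OF ex] not_less_Least by blast+
  have sd: "summable (\<lambda>k. d k * x ^ k)" if "\<bar>x\<bar> < s" for x
    using summable_diff[OF a[OF that] b[OF that]] by (simp add: d_def algebra_simps)
  define f where "f x = (\<Sum>k. d (k + n) * x ^ k)" for x
  have sums: "(\<lambda>k. d (k + n) * x ^ k) sums f x" if "x \<noteq> 0" "norm x < s" for x
  proof -
    have "summable (\<lambda>k. d (k + n) * x ^ (k + n))"
      using sd[of x] that by (subst summable_iff_shift[of "\<lambda>k. d k * x ^ k"]) auto
    then have "summable (\<lambda>k. d (k + n) * x ^ (k + n) * inverse (x ^ n))"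
      by (rule summable_mult2)
    then show ?thesis
      using that unfolding f_def by (intro summable_sums) (simp add: power_add field_simps)
  qed
  have lim: "(f \<longlongrightarrow> d (0 + n)) (at 0)"
    by (rule powser_limit_0_strong[OF s, of "\<lambda>k. d (k + n)" f]) (use sums in auto)
  have zero: "f x = 0" if "0 < x" "x < s" for x
  proof -
    have "(\<lambda>k. d k * x ^ k) sums 0"
      using sums_diff[OF summable_sums[OF a[of x]] summable_sums[OF b[of x]]] eq[OF that] that
      by (simp add: d_def algebra_simps)
    then have "(\<lambda>k. d (k + n) * x ^ (k + n)) sums 0"
      using lt by (subst (asm) sums_iff_shift'[of _ n, symmetric]) auto
    then have "(\<lambda>k. x ^ n * (d (k + n) * x ^ k)) sums 0"
      by (simp add: power_add mult_ac)
    moreover have "(\<lambda>k. x ^ n * (d (k + n) * x ^ k)) sums (x ^ n * f x)"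
      using sums[of x] that by (intro sums_mult) auto
    ultimately have "x ^ n * f x = 0"
      by (rule sums_unique2[symmetric])
    then show ?thesis using that by simp
  qed
  have "(f \<longlongrightarrow> d (0 + n)) (at_right 0)"
    using lim by (rule tendsto_mono[rotated]) (simp add: at_le)
  moreover have "(f \<longlongrightarrow> 0) (at_right 0)"
    by (rule tendsto_eventually, rule eventually_at_rightI[of 0 s]) (use zero s in auto)
  ultimately have "d (0 + n) = 0"
    by (rule tendsto_unique[rotated]) simp
  with dn show False by simp
qed

text \<open>
  The Laplace transform is expanded around the parameter \<open>1\<close>: writing \<open>r = 1 + p\<close>, every term of the
  series is nonnegative for \<open>r \<ge> 0\<close>, so integral and sum commute although for \<open>r > 1\<close> the exponential
  moment may be infinite a priori.
\<close>

lemma nn_integral_exp_series: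
  fixes Y W :: "'a \<Rightarrow> real"
  assumes [measurable]: "Y \<in> borel_measurable M" "W \<in> borel_measurable M"
    and Y: "AE x in M. 0 \<le> Y x" and W: "\<And>x. 0 \<le> W x" and r: "0 \<le> r"
  shows "(\<integral>\<^sup>+x. ennreal (exp ((r - 1) * Y x) * W x) \<partial>M)
    = (\<Sum>k. ennreal (r ^ k) * (\<integral>\<^sup>+x. ennreal (Y x ^ k / fact k * (exp (- Y x) * W x)) \<partial>M))"
proof -
  have *: "ennreal (exp ((r - 1) * y) * w)
      = (\<Sum>k. ennreal (r ^ k) * ennreal (y ^ k / fact k * (exp (- y) * w)))"
    if "0 \<le> y" "0 \<le> w" for y w
  proof -
    have "(\<lambda>k. (r * y) ^ k / fact k * (exp (- y) * w)) sums (exp (r * y) * (exp (- y) * w))"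
      using exp_converges[of "r * y"] by (intro sums_mult2) (simp add: field_simps)
    moreover have "exp (r * y) * (exp (- y) * w) = exp ((r - 1) * y) * w"
      by (simp add: exp_add[symmetric] algebra_simps flip: mult.assoc)
    ultimately have "(\<lambda>k. r ^ k * (y ^ k / fact k * (exp (- y) * w))) sums (exp ((r - 1) * y) * w)"
      by (simp only: power_mult_distrib times_divide_eq_left times_divide_eq_right mult.assoc)
    then have "ennreal (exp ((r - 1) * y) * w) = (\<Sum>k. ennreal (r ^ k * (y ^ k / fact k * (exp (- y) * w))))"
      using that r by (subst suminf_ennreal2) (auto simp: sums_iff)
    also have "(\<lambda>k. ennreal (r ^ k * (y ^ k / fact k * (exp (- y) * w))))
        = (\<lambda>k. ennreal (r ^ k) * ennreal (y ^ k / fact k * (exp (- y) * w)))"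
      using that r by (intro ext ennreal_mult) auto
    finally show ?thesis .
  qed
  have "(\<integral>\<^sup>+x. ennreal (exp ((r - 1) * Y x) * W x) \<partial>M)
    = (\<integral>\<^sup>+x. (\<Sum>k. ennreal (r ^ k) * ennreal (Y x ^ k / fact k * (exp (- Y x) * W x))) \<partial>M)"
    using Y by (intro nn_integral_cong_AE) (auto simp: * W)
  also have "\<dots> = (\<Sum>k. (\<integral>\<^sup>+x. ennreal (r ^ k) * ennreal (Y x ^ k / fact k * (exp (- Y x) * W x)) \<partial>M))"
    by (rule nn_integral_suminf) measurable
  finally show ?thesis
    by (simp add: nn_integral_cmult)
qed

text \<open>
  Under the measure with density \<open>W\<close>, the variable \<open>Y\<close> has the Laplace transform of a multiple of a
  gamma law, and the exponential moments of \<open>Y\<close> are then those of that law, up to the pole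
  \<open>p = A / B\<close>. Around the parameter \<open>1\<close> the transform has an expansion with nonnegative
  coefficients; these are identified for small parameters with the binomial coefficients of
  \<open>(A + B - B * r) powr (- \<alpha>)\<close>, and the binomial series converges until the pole. The density \<open>W\<close>
  makes it possible to treat one coordinate of a permanental pair while the other is
  exponentially tilted.
\<close>

lemma gamma_laplace_extends:
  fixes Y W :: "'a \<Rightarrow> real"
  assumes meas [measurable]: "Y \<in> borel_measurable M" "W \<in> borel_measurable M"
    and Y: "AE x in M. 0 \<le> Y x" and W: "\<And>x. 0 \<le> W x"
    and AB: "0 < A" "0 \<le> B"
    and lap: "\<And>s. 0 < s \<Longrightarrow>
      (\<integral>\<^sup>+x. ennreal (exp (- s * Y x) * W x) \<partial>M) = ennreal ((A + B * s) powr (- \<alpha>))"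
    and p: "0 \<le> p" "B * p < A"
  shows "(\<integral>\<^sup>+x. ennreal (exp (p * Y x) * W x) \<partial>M) = ennreal ((A - B * p) powr (- \<alpha>))"
proof -
  define \<mu> where "\<mu> k = (\<integral>\<^sup>+x. ennreal (Y x ^ k / fact k * (exp (- Y x) * W x)) \<partial>M)" for k
  note series = nn_integral_exp_series[OF meas Y W, folded \<mu>_def]
  have val: "(\<Sum>k. ennreal (r ^ k) * \<mu> k) = ennreal ((A + B - B * r) powr (- \<alpha>))"
    if "0 \<le> r" "r < 1" for r
    using series[OF that(1)] lap[of "1 - r"] that by (simp add: algebra_simps)
  have fin: "\<mu> k < \<infinity>" for k
  proof -
    have "ennreal ((1/2) ^ k) * \<mu> k \<le> (\<Sum>k. ennreal ((1/2) ^ k) * \<mu> k)"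
      using sum_le_suminf[of "\<lambda>k. ennreal ((1/2) ^ k) * \<mu> k" "{k}"] by simp
    also have "\<dots> < \<infinity>" using val[of "1/2"] by simp
    finally have "ennreal ((1/2) ^ k) * \<mu> k < \<infinity>" .
    then have "ennreal ((1/2) ^ k) = 0 \<or> \<mu> k = 0 \<or> \<mu> k < \<infinity>"
      unfolding infinity_ennreal_def ennreal_mult_less_top by blast
    moreover have "ennreal ((1/2) ^ k) \<noteq> 0" by (simp add: ennreal_eq_0_iff not_le)
    ultimately show ?thesis by auto
  qed
  define m where "m k = enn2real (\<mu> k)" for k
  have m: "\<mu> k = ennreal (m k)" "0 \<le> m k" for k
    using fin[of k] by (auto simp: m_def)
  define c where "c k = ((-\<alpha>) gchoose k) * (A + B) powr (- \<alpha> - real k) * (- B) ^ k" for k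
  have c_sums: "(\<lambda>k. c k * r ^ k) sums ((A + B - B * r) powr (- \<alpha>))" if "\<bar>B * r\<bar> < A + B" for r
    using gen_binomial_real''[of "- B * r" "A + B" "- \<alpha>"] that
    by (simp add: c_def power_mult_distrib[symmetric] mult.assoc)
  have m_sums: "(\<lambda>k. m k * r ^ k) sums ((A + B - B * r) powr (- \<alpha>))" if "0 \<le> r" "r < 1" for r
  proof -
    have "(\<Sum>k. ennreal (m k * r ^ k)) = ennreal ((A + B - B * r) powr (- \<alpha>))"
      using val[OF that] that by (simp add: m ennreal_mult mult.commute)
    then show ?thesis
      using that m(2) by (intro iffD1[OF sums_ennreal]) (auto simp: sums_iff)
  qed
  have "m = c"
  proof (rule powser_coeffs_eqI[of 1])
    fix x :: real assume x: "\<bar>x\<bar> < 1"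
    have "summable (\<lambda>k. m k * \<bar>x\<bar> ^ k)" using m_sums[of "\<bar>x\<bar>"] x by (simp add: sums_iff)
    then show "summable (\<lambda>k. m k * x ^ k)"
      by (rule summable_comparison_test'[where N=0]) (simp add: abs_mult power_abs m(2))
    have "\<bar>B * x\<bar> < A + B"
    proof -
      have "\<bar>B * x\<bar> \<le> B * 1" unfolding abs_mult using x AB by (intro mult_mono) auto
      then show ?thesis using AB by simp
    qed
    from c_sums[OF this] show "summable (\<lambda>k. c k * x ^ k)" by (simp add: sums_iff)
  next
    fix x :: real assume x: "0 < x" "x < 1"
    then have "B * x \<le> B * 1" using AB by (intro mult_left_mono) auto
    then have "\<bar>B * x\<bar> < A + B" using AB x by simp
    with m_sums[of x] c_sums[of x] x show "(\<Sum>k. m k * x ^ k) = (\<Sum>k. c k * x ^ k)"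
      by (simp add: sums_iff)
  qed simp
  have "(\<integral>\<^sup>+x. ennreal (exp (p * Y x) * W x) \<partial>M) = (\<Sum>k. ennreal (m k * (1 + p) ^ k))"
    using series[of "1 + p"] p m by (simp add: ennreal_mult mult.commute)
  moreover have "(\<lambda>k. m k * (1 + p) ^ k) sums ((A + B - B * (1 + p)) powr (- \<alpha>))"
    unfolding \<open>m = c\<close> using p AB by (intro c_sums) (simp add: algebra_simps)
  moreover from this have "(\<Sum>k. ennreal (m k * (1 + p) ^ k)) = ennreal (\<Sum>k. m k * (1 + p) ^ k)"
    by (intro suminf_ennreal2) (use m(2) p in \<open>auto simp: sums_iff\<close>)
  ultimately show ?thesis
    by (simp add: sums_iff algebra_simps)
qed

section \<open>Permanental variables and pairs\<close>

lemma det_mat_2: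
  assumes "A \<in> carrier_mat 2 2"
  shows "Determinant.det A = A $$ (0, 0) * A $$ (1, 1) - A $$ (0, 1) * (A $$ (1, 0) :: real)"
proof -
  have d: "dim_row A = 2" "dim_col A = 2" using assms by auto
  have m: "Determinant.det (Matrix.mat (Suc 0) (Suc 0) f) = (f (0, 0) :: real)" for f
    by (subst det_single) auto
  have "Determinant.det A = (\<Sum>j<2. A $$ (0, j) * cofactor A 0 j)"
    by (rule laplace_expansion_row[OF assms]) simp
  also have "\<dots> = A $$ (0, 0) * A $$ (1, 1) - A $$ (0, 1) * A $$ (1, 0)"
    using d by (simp add: numeral_2_eq_2 cofactor_def m mat_delete_def)
  finally show ?thesis .
qed

text \<open>
  This forbids zeros of the determinant, and thereby gives the sign conditions on the kernel:
  a determinant that is \<open>1\<close> at the origin and negative somewhere would vanish in between.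
\<close>

lemma laplace_transform_nonzero:
  fixes f :: "'a \<Rightarrow> real"
  assumes "prob_space M" and [measurable]: "f \<in> borel_measurable M" and "AE x in M. 0 \<le> f x"
  shows "integrable M (\<lambda>x. exp (- f x))" "(\<integral>x. exp (- f x) \<partial>M) \<noteq> 0"
proof -
  interpret prob_space M by fact
  show *: "integrable M (\<lambda>x. exp (- f x))"
    using assms(3) by (intro integrable_const_bound[of _ 1]) auto
  show "(\<integral>x. exp (- f x) \<partial>M) \<noteq> 0"
    using integral_nonneg_eq_0_iff_AE[OF *] by simp
qed

lemma permanental_margin:
  assumes ps: "prob_space M" and perm: "permanental_process M \<alpha> T u X" and t: "t \<in> T"
  shows "X t \<in> borel_measurable M" "AE \<omega> in M. 0 \<le> X t \<omega>" "0 \<le> u t t"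
    and "\<And>x. 0 < x \<Longrightarrow> (\<integral>\<^sup>+\<omega>. ennreal (exp (- x * X t \<omega>)) \<partial>M) = ennreal ((1 + u t t * x) powr (- \<alpha>))"
proof -
  have "permanental_vector M \<alpha> 1 (Matrix.mat 1 1 (\<lambda>(i, j). u t t)) (\<lambda>i. X t)"
    using perm t unfolding permanental_process_def by (elim allE[of _ 1] allE[of _ "\<lambda>_. t"]) simp
  note pv = this[unfolded permanental_vector_def]
  from pv show meas [measurable]: "X t \<in> borel_measurable M" and nn: "AE \<omega> in M. 0 \<le> X t \<omega>"
    by simp_all
  have lap: "(\<integral>\<omega>. exp (- (x * X t \<omega>)) \<partial>M) = (1 + u t t * x) powr (- \<alpha>)" if "0 < x" for x
  proof -
    have "(\<integral>\<omega>. exp (- (x * X t \<omega>)) \<partial>M)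
      = Determinant.det (1\<^sub>m 1 + Matrix.mat 1 1 (\<lambda>(i, j). u t t) * mat_diag 1 (\<lambda>_. x)) powr (- \<alpha>)"
      using pv that by (auto dest!: spec[of _ "\<lambda>_. x"])
    also have "Determinant.det (1\<^sub>m 1 + Matrix.mat 1 1 (\<lambda>(i, j). u t t) * mat_diag 1 (\<lambda>_. x)) = 1 + u t t * x"
      by (subst det_single) (auto simp: mat_diag_def scalar_prod_def)
    finally show ?thesis .
  qed
  have X: "(\<lambda>\<omega>. x * X t \<omega>) \<in> borel_measurable M" "AE \<omega> in M. 0 \<le> x * X t \<omega>" if "0 < x" for x
    using nn that by auto
  show u0: "0 \<le> u t t"
  proof (rule ccontr)
    assume "\<not> 0 \<le> u t t"
    then have "0 < - 1 / u t t" by (simp add: field_simps)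
    from laplace_transform_nonzero(2)[OF ps X[OF this]] lap[OF this] \<open>\<not> 0 \<le> u t t\<close>
    show False by simp
  qed
  show "(\<integral>\<^sup>+\<omega>. ennreal (exp (- x * X t \<omega>)) \<partial>M) = ennreal ((1 + u t t * x) powr (- \<alpha>))" if "0 < x" for x
    using nn_integral_eq_integral[OF laplace_transform_nonzero(1)[OF ps X[OF that]]] lap[OF that] by simp
qed

text \<open>
  In two variables the determinant is
  \<open>1 + u(s,s) x + u(t,t) y + (u(s,s) u(t,t) - u(s,t) u(t,s)) x y\<close>, which is stated here as an affine
  function of \<open>x\<close> whose coefficients depend on \<open>y\<close>: for a fixed tilt \<open>y\<close> of the variable at \<open>t\<close>, the
  variable at \<open>s\<close> has a gamma transform.
\<close>

lemma permanental_pair: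
  assumes ps: "prob_space M" and perm: "permanental_process M \<alpha> T u X" and st: "s \<in> T" "t \<in> T"
  shows "u s t * u t s \<le> u s s * u t t"
    and "\<And>x y. 0 < x \<Longrightarrow> 0 < y \<Longrightarrow> (\<integral>\<^sup>+\<omega>. ennreal (exp (- x * X s \<omega>) * exp (- y * X t \<omega>)) \<partial>M)
      = ennreal ((1 + u t t * y + (u s s + (u s s * u t t - u s t * u t s) * y) * x) powr (- \<alpha>))"
proof -
  note S = permanental_margin[OF ps perm st(1)] and T = permanental_margin[OF ps perm st(2)]
  note [measurable] = S(1) T(1)
  define r where "r = (\<lambda>i::nat. if i = 0 then s else t)"
  define U where "U = Matrix.mat 2 2 (\<lambda>(i, j). u (r i) (r j))"
  define d where "d = u s s * u t t - u s t * u t s"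
  have "permanental_vector M \<alpha> 2 U (\<lambda>i. X (r i))"
    using perm st unfolding permanental_process_def U_def
    by (elim allE[of _ 2] allE[of _ r]) (simp add: r_def)
  note pv = this[unfolded permanental_vector_def]
  have lap: "(\<integral>\<omega>. exp (- (x * X s \<omega> + y * X t \<omega>)) \<partial>M) = (1 + u s s * x + u t t * y + d * x * y) powr (- \<alpha>)"
    if "0 < x" "0 < y" for x y
  proof -
    define w where "w = (\<lambda>i::nat. if i = 0 then x else y)"
    have "(\<integral>\<omega>. exp (- (\<Sum>i<2. w i * X (r i) \<omega>)) \<partial>M) = Determinant.det (1\<^sub>m 2 + U * mat_diag 2 w) powr (- \<alpha>)"
      using pv that by (auto simp: w_def)
    also have "Determinant.det (1\<^sub>m 2 + U * mat_diag 2 w) = 1 + u s s * x + u t t * y + d * x * y"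
      by (subst det_mat_2)
         (auto simp: U_def mat_diag_def scalar_prod_def r_def w_def d_def numeral_2_eq_2 algebra_simps)
    finally show ?thesis
      by (simp add: numeral_2_eq_2 w_def r_def)
  qed
  have X: "(\<lambda>\<omega>. x * X s \<omega> + y * X t \<omega>) \<in> borel_measurable M" "AE \<omega> in M. 0 \<le> x * X s \<omega> + y * X t \<omega>"
    if "0 < x" "0 < y" for x y
    using S(2) T(2) that by auto
  have "0 \<le> d"
  proof (rule ccontr)
    assume d: "\<not> 0 \<le> d"
    define f where "f x = 1 + u s s * x + u t t * x + d * x * x" for x
    \<comment> \<open>A point beyond the positive root of the quadratic; any point where \<open>f\<close> is nonpositive would do.\<close>
    define x1 where "x1 = 1 - (u s s + u t t + 1) / d"
    have x1: "1 \<le> x1" using d S(3) T(3) by (simp add: x1_def field_simps)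
    have "d * x1 = d - (u s s + u t t + 1)" using d by (simp add: x1_def field_simps)
    then have "u s s + u t t + d * x1 = d - 1" by simp
    moreover have "f x1 = 1 + (u s s + u t t + d * x1) * x1"
      unfolding f_def by (simp add: algebra_simps)
    ultimately have "f x1 = 1 + (d - 1) * x1" by simp
    moreover have "(d - 1) * x1 \<le> d - 1" using mult_left_mono_neg[of 1 x1 "d - 1"] d x1 by simp
    ultimately have "f x1 \<le> 0" using d by linarith
    moreover have "f 0 = 1" by (simp add: f_def)
    moreover have "continuous_on {0..x1} f" unfolding f_def by (intro continuous_intros)
    ultimately obtain x where x: "0 \<le> x" "f x = 0"
      using IVT2'[of f x1 0 0] x1 by auto
    then have "0 < x" using \<open>f 0 = 1\<close> by (cases "x = 0") auto
    from laplace_transform_nonzero(2)[OF ps X[OF this this]] lap[OF this this] x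
    show False by (simp add: f_def)
  qed
  then show "u s t * u t s \<le> u s s * u t t" by (simp add: d_def)
  show "(\<integral>\<^sup>+\<omega>. ennreal (exp (- x * X s \<omega>) * exp (- y * X t \<omega>)) \<partial>M)
      = ennreal ((1 + u t t * y + (u s s + (u s s * u t t - u s t * u t s) * y) * x) powr (- \<alpha>))"
    if "0 < x" "0 < y" for x y
    using nn_integral_eq_integral[OF laplace_transform_nonzero(1)[OF ps X[OF that]]] lap[OF that]
    by (simp add: d_def exp_add[symmetric] algebra_simps)
qed

lemma permanental_mgf:
  assumes ps: "prob_space M" and perm: "permanental_process M \<alpha> T u X" and t: "t \<in> T"
    and p: "0 \<le> p" "u t t * p < 1"
  shows "(\<integral>\<^sup>+\<omega>. ennreal (exp (p * X t \<omega>)) \<partial>M) = ennreal ((1 - u t t * p) powr (- \<alpha>))"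
  using gamma_laplace_extends[of "X t" M "\<lambda>_. 1" 1 "u t t" \<alpha> p] permanental_margin[OF ps perm t] p
  by simp

text \<open>
  The exponent \<open>p\<close> may lie far beyond the exponential moments of \<open>X s\<close> alone; the tilt by \<open>q\<close> pays
  for it. This is what makes increments on the scale of the sigma function accessible.
\<close>

lemma permanental_pair_mgf:
  assumes ps: "prob_space M" and perm: "permanental_process M \<alpha> T u X" and st: "s \<in> T" "t \<in> T"
    and p: "0 \<le> p" "0 < q" and D: "(u s s + (u s s * u t t - u s t * u t s) * q) * p < 1 + u t t * q"
  shows "(\<integral>\<^sup>+\<omega>. ennreal (exp (p * X s \<omega> - q * X t \<omega>)) \<partial>M)
    = ennreal ((1 + u t t * q - (u s s + (u s s * u t t - u s t * u t s) * q) * p) powr (- \<alpha>))"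
proof -
  note S = permanental_margin[OF ps perm st(1)] and T = permanental_margin[OF ps perm st(2)]
  note P = permanental_pair[OF ps perm st]
  note [measurable] = S(1) T(1)
  have "(\<integral>\<^sup>+\<omega>. ennreal (exp (p * X s \<omega>) * exp (- q * X t \<omega>)) \<partial>M)
    = ennreal ((1 + u t t * q - (u s s + (u s s * u t t - u s t * u t s) * q) * p) powr (- \<alpha>))"
    using S(2,3) T(3) P(1) p D
    by (intro gamma_laplace_extends P(2)) (auto intro!: add_pos_nonneg mult_nonneg_nonneg add_nonneg_nonneg)
  then show ?thesis by (simp add: exp_add[symmetric])
qed

section \<open>Subgaussian increments of the square root\<close>

text \<open>
  For \<open>0 < \<kappa> \<le> 1\<close> one has \<open>(x - y)\<^sup>2 \<ge> (1 - \<kappa>) x\<^sup>2 - (1 / \<kappa> - 1) y\<^sup>2\<close> with equality at \<open>\<kappa> = y / x\<close>; the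
  square of a difference of square roots is a supremum of linear functions of the variables.
  It suffices to know \<open>1 - \<kappa> = \<omega>\<close> up to a factor of two in order to recover half of the
  supremum.
\<close>

lemma linear_minorant_sq_diff:
  fixes x y \<omega> :: real
  assumes xy: "0 \<le> y" "y < x" and \<omega>: "\<omega> \<le> (x - y) / x" "(x - y) / x \<le> 2 * \<omega>" "\<omega> < 1"
  shows "(x - y)\<^sup>2 / 2 \<le> \<omega> * x\<^sup>2 - \<omega> / (1 - \<omega>) * y\<^sup>2"
proof -
  have x: "0 < x" using xy by simp
  have le: "\<omega> * x \<le> x - y" "x - y \<le> 2 * \<omega> * x" using \<omega> x by (simp_all add: field_simps)
  have "0 < 2 * \<omega> * x" using le xy by linarith
  then have pos: "0 < \<omega>" using x by (simp add: zero_less_mult_iff)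
  have "y \<le> (1 - \<omega>) * x" using le by (simp add: algebra_simps)
  then have "y * y \<le> ((1 - \<omega>) * x) * y" using xy by (intro mult_right_mono) auto
  then have "y\<^sup>2 / (1 - \<omega>) \<le> x * y" using \<omega> by (simp add: field_simps power2_eq_square)
  then have "\<omega> * (y\<^sup>2 / (1 - \<omega>)) \<le> \<omega> * (x * y)" using pos by (intro mult_left_mono) auto
  moreover have "(x - y) * (x - y) \<le> 2 * \<omega> * x * (x - y)" using le xy by (intro mult_right_mono) auto
  then have "(x - y)\<^sup>2 \<le> 2 * (\<omega> * x\<^sup>2 - \<omega> * (x * y))" by (simp add: power2_eq_square algebra_simps)
  moreover have "c \<le> 2 * (a - b) \<Longrightarrow> d \<le> b \<Longrightarrow> c / 2 \<le> a - d" for a b c d :: real by (simp add: field_simps)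
  ultimately have "(x - y)\<^sup>2 / 2 \<le> \<omega> * x\<^sup>2 - \<omega> * (y\<^sup>2 / (1 - \<omega>))" by blast
  then show ?thesis by simp
qed

text \<open>
  A dyadic grid of slopes turns the supremum into a sum of exponentials of linear functions. The
  grid stops at \<open>2 powr (- M)\<close>: if \<open>x\<close> and \<open>y\<close> are relatively closer than that, the first term alone bounds the left-hand side.
\<close>

lemma exp_sq_diff_le_sum:
  fixes x y \<theta> :: real
  assumes xy: "0 \<le> y" "0 \<le> x" and \<theta>: "0 \<le> \<theta>"
  shows "exp (\<theta> / 2 * (max 0 (x - y))\<^sup>2)
    \<le> exp (\<theta> / 4 ^ M / 2 * x\<^sup>2)
      + (\<Sum>i<M. exp (\<theta> / 2 ^ Suc i * x\<^sup>2 - \<theta> / 2 ^ Suc i / (1 - 1 / 2 ^ Suc i) * y\<^sup>2))"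
    (is "?l \<le> ?a + (\<Sum>i<M. ?b i)")
proof (cases "y < x \<and> 1 / 2 ^ M < (x - y) / x")
  case False
  have "(max 0 (x - y))\<^sup>2 \<le> x\<^sup>2 / 4 ^ M"
  proof (cases "y < x")
    case True
    with False xy have "x - y \<le> x / 2 ^ M" by (simp add: field_simps)
    then have "(x - y)\<^sup>2 \<le> (x / 2 ^ M)\<^sup>2" using True by (intro power_mono) auto
    also have "(x / 2 ^ M)\<^sup>2 = x\<^sup>2 / 4 ^ M"
      by (simp add: power_divide power_mult[symmetric] mult.commute[of M]) (simp add: power_mult)
    finally show ?thesis using True by simp
  qed auto
  then have "\<theta> / 2 * (max 0 (x - y))\<^sup>2 \<le> \<theta> / 2 * (x\<^sup>2 / 4 ^ M)" using \<theta> by (intro mult_left_mono) auto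
  then have "?l \<le> ?a" by (simp add: algebra_simps)
  moreover have "0 \<le> (\<Sum>i<M. ?b i)" by (intro sum_nonneg) auto
  ultimately show ?thesis by linarith
next
  case True
  define z where "z = (x - y) / x"
  have z: "z \<le> 1" "1 / 2 ^ M < z" using True xy by (auto simp: z_def field_simps)
  define i where "i = (LEAST i. 1 / 2 ^ Suc i \<le> z)"
  have ex: "1 / 2 ^ Suc M \<le> z" using z by (simp add: field_simps)
  have i: "1 / 2 ^ Suc i \<le> z" "i \<le> M" unfolding i_def by (rule LeastI[of _ M], rule ex) (rule Least_le, rule ex)
  have iz: "z \<le> 2 * (1 / 2 ^ Suc i)"
  proof (cases i)
    case 0 then show ?thesis using z by simp
  next
    case (Suc j)
    then have "\<not> 1 / 2 ^ Suc j \<le> z" using not_less_Least[of j "\<lambda>i. 1 / 2 ^ Suc i \<le> z"] unfolding i_def by simp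
    then show ?thesis unfolding Suc by simp
  qed
  have "i < M" using i(2) iz z by (cases "i = M") auto
  have "\<theta> * ((x - y)\<^sup>2 / 2) \<le> \<theta> * (1 / 2 ^ Suc i * x\<^sup>2 - 1 / 2 ^ Suc i / (1 - 1 / 2 ^ Suc i) * y\<^sup>2)"
    using True xy i iz \<theta> unfolding z_def
    by (intro mult_left_mono linear_minorant_sq_diff) (auto simp: field_simps less_1_mult intro: less_le_trans[of _ 2])
  then have "?l \<le> ?b i" using True by (simp add: right_diff_distrib)
  also have "\<dots> \<le> (\<Sum>i<M. ?b i)" using \<open>i < M\<close> by (intro member_le_sum) auto
  finally show ?thesis by (simp add: add_increasing)
qed

text \<open>
  The right-hand side is the denominator in the exponential moment of a pair with
  \<open>u(s,s) = A\<^sup>2\<close>, \<open>u(t,t) = B\<^sup>2\<close> and \<open>u(s,t) u(t,s) = c\<^sup>2\<close>, for the slope \<open>1 - \<omega>\<close>. Besides staying away from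
  \<open>0\<close> it grows at least like \<open>\<omega>\<^sup>2\<close>, so the contributions of coarse slopes decay geometrically. The number
  \<open>36\<close> is chosen so that the loss from \<open>A \<noteq> B\<close>, which is at most \<open>18 \<delta>\<^sup>2 / (36 v\<^sup>2)\<close> with
  \<open>\<delta> = B - A\<close>, is at most \<open>1/2\<close>.
\<close>

lemma pair_denominator_bound:
  fixes A B c v \<omega> :: real
  assumes AB: "0 \<le> A" "0 \<le> B" and c: "0 \<le> c" "c \<le> A * B" and v: "0 < v" "A\<^sup>2 + B\<^sup>2 - 2 * c \<le> v\<^sup>2"
    and \<omega>: "0 < \<omega>" "\<omega> \<le> 1/2"
  defines "p \<equiv> 1 / (36 * v\<^sup>2) * \<omega>"
  defines "q \<equiv> p / (1 - \<omega>)"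
  shows "1/2 + 1 / (36 * v\<^sup>2) * A\<^sup>2 * \<omega>\<^sup>2 / 2 \<le> 1 + B\<^sup>2 * q - (A\<^sup>2 + (A\<^sup>2 * B\<^sup>2 - c\<^sup>2) * q) * p"
proof -
  define \<theta> where "\<theta> = 1 / (36 * v\<^sup>2)"
  have \<theta>: "0 < \<theta>" "\<theta> * v\<^sup>2 = 1/36" using v by (auto simp: \<theta>_def)
  define d where "d = A\<^sup>2 * B\<^sup>2 - c\<^sup>2"
  define \<delta> where "\<delta> = B - A"
  have sq: "A\<^sup>2 + B\<^sup>2 - 2 * c = \<delta>\<^sup>2 + 2 * (A * B - c)" by (simp add: \<delta>_def power2_eq_square algebra_simps)
  have \<delta>: "\<delta>\<^sup>2 \<le> v\<^sup>2" using sq v(2) c(2) by simp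
  have "2 * (A * B - c) \<le> v\<^sup>2"
    using v(2) unfolding sq by (rule order_trans[rotated]) simp
  then have e: "A * B - c \<le> v\<^sup>2 / 2" by simp
  have "d = (A * B - c) * (A * B + c)" by (simp add: d_def power2_eq_square algebra_simps)
  also have "\<dots> \<le> (v\<^sup>2 / 2) * (2 * (A * B))" using e c AB by (intro mult_mono) auto
  finally have "d \<le> v\<^sup>2 * (A * B)" by simp
  have p: "p = \<theta> * \<omega>" "0 < p" using \<theta> \<omega> by (auto simp: p_def \<theta>_def)
  have "d * p \<le> v\<^sup>2 * (A * B) * p" using \<open>d \<le> _\<close> p by (intro mult_right_mono) auto
  also have "\<dots> = (\<theta> * v\<^sup>2) * (A * B * \<omega>)" by (simp add: p)
  finally have dp: "d * p \<le> A * B * \<omega> / 36" using \<theta> by simp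
  have k: "1/2 \<le> 1 - \<omega>" "1 - \<omega> < 1" using \<omega> by auto
  have qk: "q * (1 - \<omega>) = p" "0 < q" using k p by (auto simp: q_def)
  \<comment> \<open>Factoring out \<open>q\<close> uses \<open>p = q * (1 - \<omega>)\<close>.\<close>
  have eq: "1 + B\<^sup>2 * q - (A\<^sup>2 + d * q) * p = 1 + q * (B\<^sup>2 - A\<^sup>2 * (1 - \<omega>) - d * p)"
    by (simp add: qk(1)[symmetric] algebra_simps)
  define Q where "Q = B\<^sup>2 - A\<^sup>2 * (1 - \<omega>) - d * p"
  have "Q \<ge> B\<^sup>2 - A\<^sup>2 * (1 - \<omega>) - A * B * \<omega> / 36" using dp by (simp add: Q_def)
  also have "B\<^sup>2 - A\<^sup>2 * (1 - \<omega>) - A * B * \<omega> / 36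
      = \<delta>\<^sup>2 + 2 * A * \<delta> + 35/36 * A\<^sup>2 * \<omega> - A * \<delta> * \<omega> / 36"
    by (simp add: \<delta>_def power2_eq_square field_simps)
  finally have Q1: "\<delta>\<^sup>2 + 2 * A * \<delta> + 35/36 * A\<^sup>2 * \<omega> - A * \<delta> * \<omega> / 36 \<le> Q" .
  have ad: "A * \<delta> * \<omega> \<le> A * \<bar>\<delta>\<bar>" 
  proof -
    have "A * \<delta> * \<omega> \<le> A * \<bar>\<delta>\<bar> * 1" using AB \<omega> by (intro mult_mono mult_left_mono mult_nonneg_nonneg) auto
    then show ?thesis by simp
  qed
  have "- (A * \<bar>\<delta>\<bar>) \<le> A * \<delta>" using AB mult_left_mono[of "- \<bar>\<delta>\<bar>" \<delta> A] by simp
  moreover have "0 \<le> A * \<bar>\<delta>\<bar>" using AB by simp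
  moreover have "\<delta>\<^sup>2 + 2 * (A * \<delta>) + 35/36 * (A\<^sup>2 * \<omega>) - (A * \<delta> * \<omega>) / 36 \<le> Q"
    using Q1 by (simp add: mult.assoc)
  moreover have "d2 + 2 * x + k - y / 36 \<le> Q' \<Longrightarrow> y \<le> m \<Longrightarrow> - m \<le> x \<Longrightarrow> 0 \<le> m \<Longrightarrow> 0 \<le> d2 \<Longrightarrow> k - 3 * m \<le> Q'"
    for d2 x k y m Q' :: real by linarith
  ultimately have Q2: "35/36 * (A\<^sup>2 * \<omega>) - 3 * (A * \<bar>\<delta>\<bar>) \<le> Q"
    using ad zero_le_power2[of \<delta>] by blast
  \<comment> \<open>The term linear in \<open>\<delta>\<close> is absorbed by the arithmetic-geometric mean inequality.\<close>
  have "(A * \<omega> / 2 - 3 * \<bar>\<delta>\<bar>)\<^sup>2 \<ge> 0" by simp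
  then have am: "3 * A * \<omega> * \<bar>\<delta>\<bar> \<le> A\<^sup>2 * \<omega>\<^sup>2 / 4 + 9 * \<delta>\<^sup>2"
    by (simp add: power2_eq_square algebra_simps)
  have "\<omega> * (35/36 * (A\<^sup>2 * \<omega>) - 3 * (A * \<bar>\<delta>\<bar>)) \<le> \<omega> * Q" using Q2 \<omega> by (intro mult_left_mono) auto
  then have "35/36 * (A\<^sup>2 * \<omega>\<^sup>2) - 3 * A * \<omega> * \<bar>\<delta>\<bar> \<le> \<omega> * Q" by (simp add: power2_eq_square algebra_simps)
  then have wQ: "A\<^sup>2 * \<omega>\<^sup>2 / 2 - 9 * v\<^sup>2 \<le> \<omega> * Q" using am \<delta> zero_le_power2[of "A * \<omega>"]
    unfolding power_mult_distrib by linarith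
  define l where "l = \<theta> / (1 - \<omega>)"
  have l: "\<theta> \<le> l" "l \<le> 2 * \<theta>" using k \<theta> by (auto simp: l_def field_simps)
  have "l * (A\<^sup>2 * \<omega>\<^sup>2 / 2 - 9 * v\<^sup>2) \<le> l * (\<omega> * Q)" using wQ l \<theta> by (intro mult_left_mono) auto
  moreover have "\<theta> * (A\<^sup>2 * \<omega>\<^sup>2 / 2) \<le> l * (A\<^sup>2 * \<omega>\<^sup>2 / 2)" using l by (intro mult_right_mono) auto
  moreover have "l * (9 * v\<^sup>2) \<le> (2 * \<theta>) * (9 * v\<^sup>2)" using l by (intro mult_right_mono) auto
  moreover have "(2 * \<theta>) * (9 * v\<^sup>2) = 1/2" using \<theta> by simp
  ultimately have "\<theta> * (A\<^sup>2 * \<omega>\<^sup>2 / 2) - 1/2 \<le> l * (\<omega> * Q)" by (simp add: right_diff_distrib)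
  also have "l * (\<omega> * Q) = q * Q" by (simp add: l_def q_def p)
  finally show ?thesis using eq unfolding Q_def d_def[symmetric] \<theta>_def[symmetric] by (simp add: mult.assoc)
qed

text \<open>
  The first summand bounds the moment left over at the end of the slope grid, the second is the sum
  of the geometric series over the grid.
\<close>

definition increment_const :: "real \<Rightarrow> real" where
  "increment_const \<alpha> = 2 powr \<alpha> + 8 powr \<alpha> / (1 - 4 powr (- \<alpha>))"

text \<open>
  The difference of the square roots of a permanental pair is subgaussian on the scale of the sigma
  function, with constants that depend on \<open>\<alpha>\<close> only. With \<open>\<theta> = 1 / (36 v\<^sup>2)\<close>, slope number \<open>i\<close> of the grid
  contributes at most a multiple of \<open>4 powr (- \<alpha> (N - i))\<close>, where the depth \<open>N\<close> of the grid is the first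
  one at which the mean of \<open>\<theta> X(s) / 4 ^ N\<close> is at most \<open>\<alpha>\<close>. The total is a geometric
  series, hence bounded regardless of how small \<open>v\<^sup>2\<close> is in comparison with \<open>u(s,s)\<close>. For
  \<open>\<alpha> = 1/2\<close> the pair has the law of halved squares of two Gaussian variables, and the bound corresponds
  to the familiar tail of a Gaussian increment.
\<close>

lemma increment_mgf:
  assumes ps: "prob_space M" and \<alpha>: "0 < \<alpha>" and perm: "permanental_process M \<alpha> T u X"
    and st: "s \<in> T" "t \<in> T" and v: "0 < v" "sigma_fun u s t \<le> v"
  shows "(\<integral>\<^sup>+\<omega>. ennreal (exp ((max 0 (sqrt (X s \<omega>) - sqrt (X t \<omega>)))\<^sup>2 / (72 * v\<^sup>2))) \<partial>M)
    \<le> ennreal (increment_const \<alpha>)"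
proof -
  note S = permanental_margin[OF ps perm st(1)] and T = permanental_margin[OF ps perm st(2)]
  note [measurable] = S(1) T(1)
  define \<theta> where "\<theta> = 1 / (36 * v\<^sup>2)"
  have \<theta>: "0 < \<theta>" "\<theta> * v\<^sup>2 = 1/36" using v by (auto simp: \<theta>_def)
  define a where "a = u s s"
  define b where "b = u t t"
  define e where "e = u s t * u t s"
  have ab: "0 \<le> a" "0 \<le> b" "e \<le> a * b" using S(3) T(3) permanental_pair(1)[OF ps perm st] by (auto simp: a_def b_def e_def)
  have sig: "a + b - 2 * sqrt e \<le> v\<^sup>2"
    using v sqrt_le_D[of "a + b - 2 * sqrt e" v] by (simp add: sigma_fun_def a_def b_def e_def)
  \<comment> \<open>A negative product \<open>e\<close> would make \<open>sqrt e\<close> negative and \<open>v\<^sup>2 \<ge> a\<close>; then the grid is empty.\<close>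
  have ea: "0 \<le> e \<or> \<theta> * a \<le> 1"
  proof (cases "0 \<le> e")
    case False
    then have "sqrt e \<le> 0" by simp
    then have "a \<le> v\<^sup>2" using sig ab by linarith
    then have "\<theta> * a \<le> \<theta> * v\<^sup>2" using \<theta> by (intro mult_left_mono) auto
    with \<theta>(2) show ?thesis by linarith
  qed simp
  have "\<exists>N. \<theta> * a \<le> 4 ^ N"
    using real_arch_pow[of 4 "\<theta> * a"] less_imp_le by auto
  then obtain N where N: "\<theta> * a \<le> 4 ^ N" "\<And>m. m < N \<Longrightarrow> 4 ^ m < \<theta> * a"
    by (meson LeastI_ex not_less_Least not_le_imp_less)
  define w where "w i = (1 / 2 ^ Suc i :: real)" for i
  define E where "E i = (\<integral>\<^sup>+\<omega>. ennreal (exp (\<theta> * w i * X s \<omega> - \<theta> * w i / (1 - w i) * X t \<omega>)) \<partial>M)" for i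
  have E: "E i \<le> ennreal (8 powr \<alpha> * (4 powr (- \<alpha>)) ^ (N - Suc i))" if i: "i < N" for i
  proof -
    have "4 ^ i < \<theta> * a" by (rule N(2)[OF i])
    moreover have "(1::real) \<le> 4 ^ i" by simp
    ultimately have e: "0 \<le> e" using ea by linarith
    have wi: "0 < w i" "w i \<le> 1/2" by (simp_all add: w_def field_simps)
    define p where "p = \<theta> * w i"
    define q where "q = p / (1 - w i)"
    have pq: "0 \<le> p" "0 < q" using \<theta> wi by (auto simp: p_def q_def)
    define D where "D = 1 + b * q - (a + (a * b - e) * q) * p"
    have "sqrt e \<le> sqrt (a * b)" using ab by simp
    then have "1/2 + 1 / (36 * v\<^sup>2) * (sqrt a)\<^sup>2 * (w i)\<^sup>2 / 2
        \<le> 1 + (sqrt b)\<^sup>2 * q - ((sqrt a)\<^sup>2 + ((sqrt a)\<^sup>2 * (sqrt b)\<^sup>2 - (sqrt e)\<^sup>2) * q) * p"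
      unfolding q_def p_def \<theta>_def
      using ab e wi v sig by (intro pair_denominator_bound) (auto simp: real_sqrt_mult)
    then have D: "1/2 + \<theta> * a * (w i)\<^sup>2 / 2 \<le> D" using ab e by (simp add: D_def \<theta>_def)
    have "4 ^ (N - Suc i) / 8 \<le> \<theta> * a * (w i)\<^sup>2 / 2"
    proof -
      have "4 ^ (N - 1) < \<theta> * a" by (rule N(2)) (use i in simp)
      moreover have "N - 1 = (N - Suc i) + i" using i by simp
      ultimately have "4 ^ (N - Suc i) * 4 ^ i < \<theta> * a" by (simp add: power_add)
      then have "4 ^ (N - Suc i) * 4 ^ i * (w i)\<^sup>2 \<le> \<theta> * a * (w i)\<^sup>2" by (intro mult_right_mono) auto
      moreover have "4 ^ i * (w i)\<^sup>2 = 1/4"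
      proof -
        have "(2 ^ i :: real)\<^sup>2 = 4 ^ i" by (simp add: power_mult[symmetric] mult.commute[of i]) (simp add: power_mult)
        then show ?thesis by (simp add: w_def power_divide power_mult_distrib)
      qed
      ultimately show ?thesis by (simp add: mult.assoc)
    qed
    with D have D2: "4 ^ (N - Suc i) / 8 \<le> D" by simp
    have pos: "(0::real) < 4 ^ (N - Suc i) / 8" by simp
    with D2 have "0 < D" by linarith
    have "E i = ennreal (D powr (- \<alpha>))"
      unfolding E_def D_def a_def b_def e_def p_def[symmetric] q_def[symmetric]
      using \<open>0 < D\<close> pq
      by (intro permanental_pair_mgf[OF ps perm st]) (auto simp: D_def a_def b_def e_def)
    also have "D powr (- \<alpha>) \<le> (4 ^ (N - Suc i) / 8) powr (- \<alpha>)"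
      using D2 pos \<alpha> by (intro powr_mono2') auto
    also have "\<dots> = 8 powr \<alpha> * (4 powr (- \<alpha>)) ^ (N - Suc i)"
      by (simp add: powr_divide powr_minus_divide powr_realpow[symmetric] powr_powr mult.commute power_divide)
    finally show ?thesis by (simp add: ennreal_leI)
  qed
  define F where "F = (\<integral>\<^sup>+\<omega>. ennreal (exp (\<theta> / 4 ^ N / 2 * X s \<omega>)) \<partial>M)"
  have F: "F \<le> ennreal (2 powr \<alpha>)"
  proof -
    have h: "a * (\<theta> / 4 ^ N / 2) \<le> 1/2" using N(1) by (simp add: field_simps)
    then have h1: "u s s * (\<theta> / 4 ^ N / 2) < 1"
      unfolding a_def by (rule order.strict_trans1) simp
    have "F = ennreal ((1 - a * (\<theta> / 4 ^ N / 2)) powr (- \<alpha>))"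
      unfolding F_def a_def using \<theta>(1) by (intro permanental_mgf[OF ps perm st(1)] h1) simp
    also have "(1 - a * (\<theta> / 4 ^ N / 2)) powr (- \<alpha>) \<le> (1/2) powr (- \<alpha>)"
      using h \<alpha> by (intro powr_mono2') auto
    also have "(1/2) powr (- \<alpha>) = 2 powr \<alpha>" by (simp add: powr_divide powr_minus_divide)
    finally show ?thesis by (simp add: ennreal_leI)
  qed
  have geo: "(\<Sum>i<N. (4 powr (- \<alpha>)) ^ (N - Suc i)) \<le> 1 / (1 - 4 powr (- \<alpha>))"
  proof -
    have r: "4 powr (- \<alpha>) < 1" "0 < 4 powr (- \<alpha>)" using \<alpha> by (auto simp: powr_less_one)
    have "(\<Sum>i<N. (4 powr (- \<alpha>)) ^ (N - Suc i)) = (\<Sum>i<N. (4 powr (- \<alpha>)) ^ i)"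
      by (rule sum.nat_diff_reindex)
    also have "\<dots> \<le> (\<Sum>i. (4 powr (- \<alpha>)) ^ i)"
      using r by (intro sum_le_suminf summable_geometric) auto
    finally show ?thesis using suminf_geometric[of "4 powr (- \<alpha>)"] r by simp
  qed
  have "(\<integral>\<^sup>+\<omega>. ennreal (exp ((max 0 (sqrt (X s \<omega>) - sqrt (X t \<omega>)))\<^sup>2 / (72 * v\<^sup>2))) \<partial>M)
    \<le> (\<integral>\<^sup>+\<omega>. ennreal (exp (\<theta> / 4 ^ N / 2 * X s \<omega>))
        + (\<Sum>i<N. ennreal (exp (\<theta> * w i * X s \<omega> - \<theta> * w i / (1 - w i) * X t \<omega>))) \<partial>M)"
  proof (rule nn_integral_mono_AE)
    show "AE \<omega> in M. ennreal (exp ((max 0 (sqrt (X s \<omega>) - sqrt (X t \<omega>)))\<^sup>2 / (72 * v\<^sup>2)))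
      \<le> ennreal (exp (\<theta> / 4 ^ N / 2 * X s \<omega>))
        + (\<Sum>i<N. ennreal (exp (\<theta> * w i * X s \<omega> - \<theta> * w i / (1 - w i) * X t \<omega>)))"
      using S(2) T(2)
    proof eventually_elim
      case (elim \<omega>)
      have "exp ((max 0 (sqrt (X s \<omega>) - sqrt (X t \<omega>)))\<^sup>2 / (72 * v\<^sup>2))
        \<le> exp (\<theta> / 4 ^ N / 2 * X s \<omega>) + (\<Sum>i<N. exp (\<theta> * w i * X s \<omega> - \<theta> * w i / (1 - w i) * X t \<omega>))"
        using exp_sq_diff_le_sum[of "sqrt (X t \<omega>)" "sqrt (X s \<omega>)" \<theta> N] elim \<theta>
        by (simp add: w_def \<theta>_def)
      then show ?case
        by (simp add: sum_nonneg flip: ennreal_plus)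
    qed
  qed
  also have "\<dots> = F + (\<Sum>i<N. E i)"
    unfolding F_def E_def by (simp add: nn_integral_add nn_integral_sum del: sum_ennreal)
  also have "\<dots> \<le> ennreal (2 powr \<alpha>) + (\<Sum>i<N. ennreal (8 powr \<alpha> * (4 powr (- \<alpha>)) ^ (N - Suc i)))"
    by (intro add_mono F sum_mono E) auto
  also have "\<dots> = ennreal (2 powr \<alpha> + 8 powr \<alpha> * (\<Sum>i<N. (4 powr (- \<alpha>)) ^ (N - Suc i)))"
    by (simp add: sum_nonneg sum_distrib_left flip: ennreal_plus)
  also have "\<dots> \<le> ennreal (increment_const \<alpha>)"
    unfolding increment_const_def using mult_left_mono[OF geo, of "8 powr \<alpha>"] by (intro ennreal_leI) simp
  finally show ?thesis .
qed

lemma exponential_Markov: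
  assumes [measurable]: "f \<in> borel_measurable M" and c: "0 \<le> K"
    and bound: "(\<integral>\<^sup>+\<omega>. ennreal (exp (f \<omega>)) \<partial>M) \<le> ennreal K"
  shows "measure M {\<omega> \<in> space M. y < f \<omega>} \<le> K * exp (- y)"
proof -
  have "emeasure M {\<omega> \<in> space M. y < f \<omega>} = (\<integral>\<^sup>+\<omega>. indicator {\<omega> \<in> space M. y < f \<omega>} \<omega> \<partial>M)"
    by simp
  also have "\<dots> \<le> (\<integral>\<^sup>+\<omega>. ennreal (exp (- y)) * ennreal (exp (f \<omega>)) \<partial>M)"
    by (intro nn_integral_mono) (auto simp: indicator_def exp_add[symmetric] simp flip: ennreal_mult)
  also have "\<dots> \<le> ennreal (exp (- y)) * ennreal K"
    by (subst nn_integral_cmult) (auto intro: mult_left_mono bound)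
  also have "\<dots> = ennreal (K * exp (- y))" using c by (simp add: ennreal_mult mult.commute)
  finally show ?thesis
    unfolding measure_def using c by (intro enn2real_leI) auto
qed

text \<open>
  The bound for the positive part applies in both directions, since the sigma function is symmetric.
\<close>

lemma increment_tail:
  assumes ps: "prob_space M" and \<alpha>: "0 < \<alpha>" and perm: "permanental_process M \<alpha> T u X"
    and st: "s \<in> T" "t \<in> T" and v: "0 < v" "sigma_fun u s t \<le> v" and x: "0 \<le> x"
  shows "measure M {\<omega> \<in> space M. v * x < \<bar>sqrt (X s \<omega>) - sqrt (X t \<omega>)\<bar>}
    \<le> 2 * increment_const \<alpha> * exp (- (x\<^sup>2 / 72))"
proof -
  interpret prob_space M by (rule ps)
  have K: "0 \<le> increment_const \<alpha>"
    using \<alpha> powr_mono[of "- \<alpha>" 0 4] by (auto simp: increment_const_def powr_le1 less_imp_le intro!: add_nonneg_nonneg divide_nonneg_nonneg)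
  have one: "measure M {\<omega> \<in> space M. v * x < sqrt (X s \<omega>) - sqrt (X t \<omega>)} \<le> increment_const \<alpha> * exp (- (x\<^sup>2 / 72))"
    (is "measure M ?A \<le> _")
    if st: "s \<in> T" "t \<in> T" and v: "0 < v" "sigma_fun u s t \<le> v" for s t
  proof -
    note [measurable] = permanental_margin(1)[OF ps perm st(1)] permanental_margin(1)[OF ps perm st(2)]
    define f where "f \<omega> = (max 0 (sqrt (X s \<omega>) - sqrt (X t \<omega>)))\<^sup>2 / (72 * v\<^sup>2)" for \<omega>
    have [measurable]: "f \<in> borel_measurable M" unfolding f_def by measurable
    have "?A \<subseteq> {\<omega> \<in> space M. x\<^sup>2 / 72 < f \<omega>}"
    proof safe
      fix \<omega> assume "v * x < sqrt (X s \<omega>) - sqrt (X t \<omega>)"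
      then have "(v * x)\<^sup>2 < (max 0 (sqrt (X s \<omega>) - sqrt (X t \<omega>)))\<^sup>2"
        using v x by (intro power_strict_mono) auto
      then show "x\<^sup>2 / 72 < f \<omega>" using v by (simp add: f_def field_simps power_mult_distrib)
    qed
    then have "measure M ?A \<le> measure M {\<omega> \<in> space M. x\<^sup>2 / 72 < f \<omega>}"
      by (intro finite_measure_mono) auto
    also have "\<dots> \<le> increment_const \<alpha> * exp (- (x\<^sup>2 / 72))"
      using increment_mgf[OF ps \<alpha> perm st v] K unfolding f_def[symmetric]
      by (intro exponential_Markov) auto
    finally show ?thesis .
  qed
  note [measurable] = permanental_margin(1)[OF ps perm st(1)] permanental_margin(1)[OF ps perm st(2)]
  have "sigma_fun u t s = sigma_fun u s t"
    by (simp add: sigma_fun_def mult.commute add.commute)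
  with v have v': "sigma_fun u t s \<le> v" by simp
  have "measure M {\<omega> \<in> space M. v * x < \<bar>sqrt (X s \<omega>) - sqrt (X t \<omega>)\<bar>}
    \<le> measure M ({\<omega> \<in> space M. v * x < sqrt (X s \<omega>) - sqrt (X t \<omega>)}
        \<union> {\<omega> \<in> space M. v * x < sqrt (X t \<omega>) - sqrt (X s \<omega>)})"
    by (intro finite_measure_mono) (auto simp: abs_if split: if_splits)
  also have "\<dots> \<le> measure M {\<omega> \<in> space M. v * x < sqrt (X s \<omega>) - sqrt (X t \<omega>)}
      + measure M {\<omega> \<in> space M. v * x < sqrt (X t \<omega>) - sqrt (X s \<omega>)}"
    by (intro measure_Un_le) auto
  also have "\<dots> \<le> increment_const \<alpha> * exp (- (x\<^sup>2 / 72)) + increment_const \<alpha> * exp (- (x\<^sup>2 / 72))"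
    using one[OF st v] one[OF st(2,1) v(1) v'] by (intro add_mono)
  finally show ?thesis by simp
qed

lemma margin_tail:
  assumes ps: "prob_space M" and perm: "permanental_process M \<alpha> T u X"
    and t: "t \<in> T" and u: "0 < u t t" and p: "0 \<le> p" "p < 1"
  shows "measure M {\<omega> \<in> space M. u t t * y < X t \<omega>} \<le> (1 - p) powr (- \<alpha>) * exp (- (p * y))"
proof -
  interpret prob_space M by (rule ps)
  note [measurable] = permanental_margin(1)[OF ps perm t]
  show ?thesis
  proof (cases "p = 0")
    case False
    have "{\<omega> \<in> space M. u t t * y < X t \<omega>} = {\<omega> \<in> space M. p * y < p / u t t * X t \<omega>}"
      using u p False by (auto simp: field_simps)
    moreover have "measure M {\<omega> \<in> space M. p * y < p / u t t * X t \<omega>} \<le> (1 - p) powr (- \<alpha>) * exp (- (p * y))"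
      using permanental_mgf[OF ps perm t, of "p / u t t"] p u by (intro exponential_Markov) auto
    ultimately show ?thesis by simp
  qed simp
qed

section \<open>Consequences of the growth and entropy conditions\<close>

text \<open>
  Hence the square root of the diagonal of the kernel moves no faster than the process, which
  makes the normalisation nearly constant on a short block of times.
\<close>

lemma sqrt_diag_le_sigma_fun:
  assumes "0 \<le> u s s" "0 \<le> u t t" "u s t * u t s \<le> u s s * u t t"
  shows "\<bar>sqrt (u s s) - sqrt (u t t)\<bar> \<le> sigma_fun u s t"
proof -
  have "sqrt (u s t * u t s) \<le> sqrt (u s s) * sqrt (u t t)"
    using assms by (simp flip: real_sqrt_mult)
  then have "(sqrt (u s s) - sqrt (u t t))\<^sup>2 \<le> u s s + u t t - 2 * sqrt (u s t * u t s)"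
    using assms by (simp add: power2_diff)
  then have "sqrt ((sqrt (u s s) - sqrt (u t t))\<^sup>2) \<le> sigma_fun u s t"
    unfolding sigma_fun_def by (rule real_sqrt_le_mono)
  then show ?thesis by simp
qed

text \<open>
  Doubling the argument multiplies the function by nearly \<open>2 powr \<rho>\<close>; since \<open>\<rho> > 0\<close>, the smaller factor
  \<open>2 powr (\<rho> / 2) = 1 / q\<^sup>2\<close> exceeds \<open>1\<close>.
\<close>

lemma regularly_varying_dyadic_growth:
  fixes f :: "real \<Rightarrow> real"
  assumes "0 < \<rho>" "regularly_varying f \<rho>"
  obtains q where "0 < q" "q < (1::real)" "\<forall>\<^sub>F t in at_top. 0 < f t \<and> f t \<le> q\<^sup>2 * f (2 * t)"
proof -
  define q where "q = (2::real) powr (- (\<rho> / 4))"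
  have q: "0 < q" "q < 1" using assms by (auto simp: q_def powr_less_one)
  have q2: "1 / q\<^sup>2 = 2 powr (\<rho> / 2)"
    by (simp add: q_def powr_minus_divide power2_eq_square powr_add[symmetric] divide_simps)
  have "((\<lambda>t. f (2 * t) / f t) \<longlongrightarrow> 2 powr \<rho>) at_top"
    using assms by (simp add: regularly_varying_def)
  moreover have "2 powr (\<rho> / 2) < 2 powr \<rho>" using assms by simp
  ultimately have "\<forall>\<^sub>F t in at_top. 2 powr (\<rho> / 2) < f (2 * t) / f t"
    by (rule order_tendstoD)
  moreover from assms(2) obtain a where "\<forall>t\<ge>a. 0 < f t" by (auto simp: regularly_varying_def)
  then have "\<forall>\<^sub>F t in at_top. 0 < f t" by (auto simp: eventually_at_top_linorder)
  ultimately have "\<forall>\<^sub>F t in at_top. 0 < f t \<and> f t \<le> q\<^sup>2 * f (2 * t)"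
  proof eventually_elim
    case (elim t)
    then have "1 / q\<^sup>2 * f t \<le> f (2 * t)" by (simp add: q2 field_simps)
    with elim q show ?case by (simp add: field_simps)
  qed
  with q show ?thesis by (rule that)
qed

lemma filterlim_power2_at_top: "filterlim (\<lambda>n. (2::real) ^ n) at_top sequentially"
proof (rule filterlim_at_top_mono[OF filterlim_real_sequentially])
  show "\<forall>\<^sub>F n in sequentially. real n \<le> 2 ^ n"
    by (intro always_eventually allI less_imp_le of_nat_less_two_power)
qed

text \<open>
  Iterating the growth over dyadic scales makes the modulus at scale \<open>2 ^ r\<close> geometrically smaller
  than the standard deviation at time \<open>2 ^ n\<close>. Scales below the threshold from which growth is
  available are finitely many and only enlarge \<open>C\<close>, by monotonicity of the modulus.
\<close>

lemma regularly_varying_dominates_dyadic: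
  fixes f \<phi> :: "real \<Rightarrow> real"
  assumes "0 < \<rho>" "regularly_varying f \<rho>"
    and big: "(\<lambda>t. (\<phi> t)\<^sup>2) \<in> O[at_top](f)"
    and mono: "mono_on {0..} \<phi>"
  obtains q C N where "0 < q" "q < (1::real)" "0 < C"
    "\<And>n. N \<le> n \<Longrightarrow> 0 < f (2 ^ n)"
    "\<And>n r. N \<le> n \<Longrightarrow> r \<le> n \<Longrightarrow> \<phi> (2 ^ r) \<le> C * sqrt (f (2 ^ n)) * q ^ (n - r)"
    "(\<lambda>n. real n / f (2 ^ n)) \<longlonglongrightarrow> 0"
proof -
  obtain q where q: "0 < q" "q < (1::real)" and
    ev: "\<forall>\<^sub>F t in at_top. 0 < f t \<and> f t \<le> q\<^sup>2 * f (2 * t)"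
    using regularly_varying_dyadic_growth[OF assms(1,2)] .
  obtain c where c: "0 < c" and evc: "\<forall>\<^sub>F t in at_top. norm ((\<phi> t)\<^sup>2) \<le> c * norm (f t)"
    using landau_o.bigE[OF big] by blast
  from eventually_conj[OF ev evc]
  have "\<forall>\<^sub>F n in sequentially. (0 < f (2 ^ n) \<and> f (2 ^ n) \<le> q\<^sup>2 * f (2 * 2 ^ n))
      \<and> norm ((\<phi> (2 ^ n))\<^sup>2) \<le> c * norm (f (2 ^ n))"
    by (rule eventually_compose_filterlim[OF _ filterlim_power2_at_top])
  then obtain J where J': "\<And>n. n \<ge> J \<Longrightarrow> (0 < f (2 ^ n) \<and> f (2 ^ n) \<le> q\<^sup>2 * f (2 * 2 ^ n))
      \<and> norm ((\<phi> (2 ^ n))\<^sup>2) \<le> c * norm (f (2 ^ n))"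
    by (auto simp: eventually_sequentially)
  have J: "0 < f (2 ^ n)" "f (2 ^ n) \<le> q\<^sup>2 * f (2 ^ Suc n)" "(\<phi> (2 ^ n))\<^sup>2 \<le> c * f (2 ^ n)"
    if "J \<le> n" for n using J'[OF that] by auto
  have grow: "f (2 ^ r) \<le> (q ^ k)\<^sup>2 * f (2 ^ (r + k))" if "J \<le> r" for r k
  proof (induction k)
    case (Suc k)
    have "(q ^ k)\<^sup>2 * f (2 ^ (r + k)) \<le> (q ^ k)\<^sup>2 * (q\<^sup>2 * f (2 ^ Suc (r + k)))"
      using that by (intro mult_left_mono J(2)) auto
    with Suc show ?case by (simp add: power_mult_distrib mult_ac)
  qed simp
  have main: "\<phi> (2 ^ r) \<le> sqrt c * sqrt (f (2 ^ n)) * q ^ (n - r)" if "J \<le> r" "r \<le> n" for r n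
  proof -
    have "(\<phi> (2 ^ r))\<^sup>2 \<le> c * f (2 ^ r)" using J(3) that by simp
    also have "\<dots> \<le> c * ((q ^ (n - r))\<^sup>2 * f (2 ^ n))"
      using grow[of r "n - r"] that c by (intro mult_left_mono) auto
    finally have "sqrt ((\<phi> (2 ^ r))\<^sup>2) \<le> sqrt (c * ((q ^ (n - r))\<^sup>2 * f (2 ^ n)))"
      by (rule real_sqrt_le_mono)
    then show ?thesis using q by (simp add: real_sqrt_mult mult_ac abs_le_iff)
  qed
  define C where "C = sqrt c / q ^ J"
  have C: "0 < C" "sqrt c \<le> C"
    using c q power_le_one[of q J] by (auto simp: C_def field_simps mult_left_le)
  have "\<phi> (2 ^ r) \<le> C * sqrt (f (2 ^ n)) * q ^ (n - r)" if n: "J \<le> n" and r: "r \<le> n" for n r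
  proof (cases "J \<le> r")
    case True
    have "sqrt c * (sqrt (f (2 ^ n)) * q ^ (n - r)) \<le> C * (sqrt (f (2 ^ n)) * q ^ (n - r))"
      using C q J(1)[OF n] by (intro mult_right_mono) auto
    with main[OF True r] show ?thesis by (simp add: mult.assoc)
  next
    case False
    have "\<phi> (2 ^ r) \<le> \<phi> (2 ^ J)"
      using False by (intro mono_onD[OF mono]) auto
    also have "\<dots> \<le> sqrt c * sqrt (f (2 ^ n)) * q ^ (n - J)" using main[of J n] n by simp
    also have "\<dots> = C * sqrt (f (2 ^ n)) * q ^ n"
      using q n by (simp add: C_def power_diff)
    also have "\<dots> \<le> C * sqrt (f (2 ^ n)) * q ^ (n - r)"
      using C q J(1)[OF n] by (intro mult_left_mono power_decreasing) auto
    finally show ?thesis .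
  qed
  moreover have "(\<lambda>n. real n / f (2 ^ n)) \<longlonglongrightarrow> 0"
  proof (rule real_tendsto_sandwich[of "\<lambda>_. 0"])
    define a where "a = f (2 ^ J) * (q ^ J)\<^sup>2"
    have a: "0 < a" using J(1)[of J] q by (simp add: a_def)
    have q2: "0 < q\<^sup>2" "q\<^sup>2 < 1" using q by (auto simp: power_less_one_iff)
    have lb: "0 < f (2 ^ n) \<and> a \<le> (q\<^sup>2) ^ n * f (2 ^ n)" if "J \<le> n" for n
    proof -
      have "a \<le> ((q ^ (n - J))\<^sup>2 * f (2 ^ n)) * (q ^ J)\<^sup>2"
        unfolding a_def using grow[of J "n - J"] that by (intro mult_right_mono) auto
      also have "\<dots> = (q ^ (n - J) * q ^ J)\<^sup>2 * f (2 ^ n)" by (simp add: power_mult_distrib)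
      also have "q ^ (n - J) * q ^ J = q ^ n" using that by (simp flip: power_add)
      finally show ?thesis
        using J(1)[OF that] by (simp add: power_mult[symmetric] mult.commute)
    qed
    show "\<forall>\<^sub>F n in sequentially. 0 \<le> real n / f (2 ^ n)"
      using J(1) by (auto simp: eventually_sequentially intro!: exI[of _ J] divide_nonneg_pos)
    show "\<forall>\<^sub>F n in sequentially. real n / f (2 ^ n) \<le> 1 / a * (real n * (q\<^sup>2) ^ n)"
    proof (rule eventually_sequentiallyI[of J])
      fix n assume "J \<le> n"
      from lb[OF this] have f: "0 < f (2 ^ n)" "a \<le> (q\<^sup>2) ^ n * f (2 ^ n)" by auto
      have "real n * a \<le> real n * ((q\<^sup>2) ^ n * f (2 ^ n))" using f by (intro mult_left_mono) auto
      then show "real n / f (2 ^ n) \<le> 1 / a * (real n * (q\<^sup>2) ^ n)"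
        using f a by (simp add: field_simps)
    qed
    have "(\<lambda>n. real n * (q\<^sup>2) ^ n) \<longlonglongrightarrow> 0"
      using q2 by (intro powser_times_n_limit_0) auto
    then show "(\<lambda>n. 1 / a * (real n * (q\<^sup>2) ^ n)) \<longlonglongrightarrow> 0"
      by (rule tendsto_mult_right_zero)
  qed auto
  ultimately show ?thesis using q C J(1) by (intro that[of q C J]) auto
qed

text \<open>
  Chaining with dyadic steps would lose too much at small scales; steps \<open>2 / 2 ^ 2 ^ k\<close> of
  doubly exponential size match the integral condition exactly. On the interval
  between consecutive steps, \<open>\<phi>\<close> is bounded below by its value at the left end and
  \<open>ln (1 / x)\<close> is of order \<open>2 ^ k\<close>, so the integral over it is at least a multiple of the \<open>k\<close>-th term.
\<close>

lemma entropy_integral_imp_summable: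
  fixes \<phi> :: "real \<Rightarrow> real"
  assumes mono: "mono_on {0..} \<phi>" and nonneg: "\<And>h. 0 \<le> h \<Longrightarrow> 0 \<le> \<phi> h"
    and int: "set_integrable lborel {0<..<1/2} (\<lambda>x. \<phi> x / (x * sqrt (ln (1 / x))))"
  shows "summable (\<lambda>k. sqrt (2 ^ k) * \<phi> (2 / 2 ^ 2 ^ k))"
proof -
  define e where "e j = (1 / 2 ^ 2 ^ j :: real)" for j :: nat
  define a where "a j = sqrt (2 ^ Suc j) * \<phi> (2 * e (Suc j))" for j
  define A where "A j = {2 * e (Suc j)..e j}" for j
  define f where "f x = \<phi> x / (x * sqrt (ln (1 / x)))" for x
  have e_pos: "0 < e j" for j by (simp add: e_def)
  have ln_e: "ln (e j) = - (2 ^ j * ln 2)" for j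
    by (simp add: e_def ln_div ln_realpow)
  have e_mono: "e j \<le> e i" if "i \<le> j" for i j
    using that by (simp add: e_def field_simps power_increasing)
  have e_lt: "2 * e (Suc j) \<le> e j" for j
  proof -
    have "(2::real) * 2 ^ 2 ^ j \<le> 2 ^ 2 ^ Suc j"
      by (subst power_Suc[symmetric], rule power_increasing) (auto simp: Suc_le_eq less_exp)
    then show ?thesis by (simp add: e_def field_simps)
  qed
  have e1: "e 1 = 1/4" by (simp add: e_def)
  have sub: "A j \<subseteq> {0<..<1/2}" if "1 \<le> j" for j
    using e_pos[of "Suc j"] e_mono[OF that] e1 by (auto simp: A_def)
  have disj: "disjoint_family_on A {1..}"
  proof -
    have *: "A i \<inter> A j = {}" if "i < j" for i j
    proof -
      have "e j \<le> e (Suc i)" using that by (intro e_mono) simp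
      then show ?thesis using e_pos[of "Suc i"] by (auto simp: A_def)
    qed
    have "A i \<inter> A j = {}" if "i \<noteq> j" for i j
      using *[of i j] *[of j i] that by (cases "i < j") auto
    then show ?thesis by (auto simp: disjoint_family_on_def)
  qed
  have lower: "sqrt (ln 2) / 4 * a j \<le> (LINT x:A j|lborel. f x)" if j: "1 \<le> j" for j
  proof -
    define b where "b = \<phi> (2 * e (Suc j)) / sqrt (2 ^ Suc j * ln 2)"
    have b: "0 \<le> b" using nonneg[of "2 * e (Suc j)"] e_pos[of "Suc j"] by (simp add: b_def)
    have ftc: "has_bochner_integral lborel (\<lambda>x. 1 / x * indicator (A j) x) (ln (e j) - ln (2 * e (Suc j)))"
      unfolding A_def
    proof (rule has_bochner_integral_FTC_Icc_real[OF e_lt])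
      fix x assume "2 * e (Suc j) \<le> x" "x \<le> e j"
      with e_pos[of "Suc j"] have "0 < x" by simp
      then show "DERIV ln x :> 1 / x" "isCont ((/) 1) x"
        by (auto intro!: derivative_eq_intros continuous_intros)
    qed
    have "(2 ^ j - 1) * ln 2 = ln (e j) - ln (2 * e (Suc j))"
      using e_pos[of "Suc j"] by (simp add: ln_mult ln_e algebra_simps)
    then have "(LINT x:A j|lborel. 1 / x) = (2 ^ j - 1) * ln 2"
      using ftc by (simp add: has_bochner_integral_iff set_lebesgue_integral_def)
    then have val: "(LINT x:A j|lborel. b * (1 / x)) = b * ((2 ^ j - 1) * ln 2)"
      by (simp only: set_integral_mult_right)
    have intb: "set_integrable lborel (A j) (\<lambda>x. b * (1 / x))"
      using ftc by (intro set_integrable_mult_right)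
        (simp add: has_bochner_integral_iff set_integrable_def mult.commute)
    have intf: "set_integrable lborel (A j) f"
      using int unfolding f_def by (rule set_integrable_subset) (use sub[OF j] in \<open>auto simp: A_def\<close>)
    have "(LINT x:A j|lborel. b * (1 / x)) \<le> (LINT x:A j|lborel. f x)"
    proof (rule set_integral_mono[OF intb intf])
      fix x assume x: "x \<in> A j"
      then have x0: "0 < x" "x < 1/2" using sub[OF j] by auto
      have "e (Suc j) \<le> x" using x e_pos[of "Suc j"] by (auto simp: A_def)
      then have "ln (e (Suc j)) \<le> ln x" using e_pos[of "Suc j"] x0 by simp
      then have "ln (1 / x) \<le> 2 ^ Suc j * ln 2" using x0 by (simp add: ln_e ln_div)
      moreover have "0 < ln (1 / x)" using x0 by (intro ln_gt_zero) (simp add: field_simps)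
      moreover have "\<phi> (2 * e (Suc j)) \<le> \<phi> x"
        using x e_pos[of "Suc j"] by (intro mono_onD[OF mono]) (auto simp: A_def)
      ultimately have "b \<le> \<phi> x / sqrt (ln (1 / x))"
        unfolding b_def using nonneg[of "2 * e (Suc j)"] e_pos[of "Suc j"] by (intro frac_le) auto
      then have "b / x \<le> \<phi> x / sqrt (ln (1 / x)) / x" using x0 by (intro divide_right_mono) auto
      then show "b * (1 / x) \<le> f x" by (simp add: f_def mult.commute)
    qed
    then have "b * ((2 ^ j - 1) * ln 2) \<le> (LINT x:A j|lborel. f x)" unfolding val .
    moreover have "sqrt (ln 2) / 4 * a j \<le> b * ((2 ^ j - 1) * ln 2)"
    proof -
      have "(2::real) \<le> 2 ^ j" using power_increasing[of 1 j "2::real"] j by simp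
      then have "2 ^ Suc j / 4 \<le> (2 ^ j - 1 :: real)" by simp
      then have "b * (2 ^ Suc j / 4 * ln 2) \<le> b * ((2 ^ j - 1) * ln 2)"
        using b by (intro mult_left_mono mult_right_mono) auto
      moreover have "sqrt (ln 2) / 4 * a j = b * (2 ^ Suc j / 4 * ln 2)"
      proof -
        have "sqrt (ln 2) / 4 * a j = \<phi> (2 * e (Suc j)) / 4 * sqrt (2 ^ Suc j * ln 2)"
          by (simp add: a_def real_sqrt_mult)
        also have "sqrt (2 ^ Suc j * ln 2) = (2 ^ Suc j * ln 2) / sqrt (2 ^ Suc j * ln (2::real))"
          by (rule real_div_sqrt[symmetric]) simp
        also have "\<phi> (2 * e (Suc j)) / 4 * \<dots> = b * (2 ^ Suc j / 4 * ln 2)"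
          by (simp add: b_def mult_ac)
        finally show ?thesis .
      qed
      ultimately show ?thesis by metis
    qed
    ultimately show ?thesis by (rule order_trans[rotated])
  qed
  have "summable (\<lambda>j. sqrt (ln 2) / 4 * a (Suc j))"
  proof (rule summableI_nonneg_bounded)
    show "0 \<le> sqrt (ln 2) / 4 * a (Suc j)" for j
      using nonneg[of "2 * e (Suc (Suc j))"] e_pos[of "Suc (Suc j)"] by (simp add: a_def)
    show "(\<Sum>j<n. sqrt (ln 2) / 4 * a (Suc j)) \<le> (LINT x:{0<..<1/2}|lborel. f x)" for n
    proof -
      have int': "set_integrable lborel B f" if "B \<in> sets lborel" "B \<subseteq> {0<..<1/2}" for B
        using int that unfolding f_def by (rule set_integrable_subset)
      have U: "(\<Union>j<n. A (Suc j)) \<subseteq> {0<..<1/2}" using sub by auto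
      have Um: "(\<Union>j<n. A (Suc j)) \<in> sets lborel" by (auto simp: A_def)
      have "(\<Sum>j<n. sqrt (ln 2) / 4 * a (Suc j)) \<le> (\<Sum>j<n. LINT x:A (Suc j)|lborel. f x)"
        by (intro sum_mono lower) simp
      also have "\<dots> = (LINT x:(\<Union>j<n. A (Suc j))|lborel. f x)"
      proof (rule set_integral_finite_Union[symmetric])
        show "disjoint_family_on (\<lambda>j. A (Suc j)) {..<n}"
          using disj by (auto simp: disjoint_family_on_def)
        show "set_integrable lborel (A (Suc j)) f" for j
          by (rule int') (use sub[of "Suc j"] in \<open>auto simp: A_def\<close>)
      qed (auto simp: A_def)
      also have "\<dots> \<le> (LINT x:{0<..<1/2}|lborel. f x)"
        using int'[OF Um U] int'[of "{0<..<1/2}"] U nonneg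
        unfolding set_lebesgue_integral_def set_integrable_def
        by (intro integral_mono) (auto simp: indicator_def f_def)
      finally show ?thesis .
    qed
  qed
  then have "summable (\<lambda>j. a (Suc j))"
    by (subst (asm) summable_cmult_iff) auto
  then show ?thesis
    by (subst summable_iff_shift[symmetric, of _ 2]) (simp add: a_def e_def)
qed

section \<open>Chaining for subgaussian increments\<close>

lemma (in prob_space) AE_eventually_notin:
  assumes "\<And>n. B n \<in> sets M" "summable b" "\<And>n. n \<ge> N \<Longrightarrow> prob (B n) \<le> b n"
  shows "AE \<omega> in M. \<forall>\<^sub>F n in sequentially. \<omega> \<notin> B n"
proof -
  have "summable (\<lambda>n. prob (B n))"
    by (rule summable_comparison_test'[OF assms(2), of N]) (use assms(3) in auto)
  then have "AE \<omega> in M. \<forall>\<^sub>F n in sequentially. \<omega> \<in> space M - B n"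
    using assms(1) by (intro borel_cantelli_AE1) (auto simp: emeasure_eq_measure)
  then show ?thesis
    by (rule AE_mp) (auto intro!: AE_I2 elim: eventually_mono)
qed

text \<open>
  The setting for both chaining arguments; the denominator \<open>72\<close> is the one of the square roots of
  permanental processes.
\<close>

locale subgaussian_increments = prob_space M
  for M :: "'a measure" +
  fixes Z :: "real \<Rightarrow> 'a \<Rightarrow> real" and \<phi> :: "real \<Rightarrow> real" and K :: real
  assumes measurable_Z: "\<And>t. 0 \<le> t \<Longrightarrow> Z t \<in> borel_measurable M"
    and tail: "\<And>s t v x. 0 \<le> s \<Longrightarrow> 0 \<le> t \<Longrightarrow> 0 < v \<Longrightarrow> \<phi> \<bar>t - s\<bar> \<le> v \<Longrightarrow> 0 \<le> x \<Longrightarrow>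
        prob {\<omega> \<in> space M. v * x < \<bar>Z s \<omega> - Z t \<omega>\<bar>} \<le> K * exp (- (x\<^sup>2 / 72))"
begin

lemma sets_increment [measurable]:
  assumes "0 \<le> s" "0 \<le> t"
  shows "{\<omega> \<in> space M. c < \<bar>Z s \<omega> - Z t \<omega>\<bar>} \<in> sets M"
  using measurable_Z[OF assms(1)] measurable_Z[OF assms(2)] by measurable

lemma K_nonneg: "0 \<le> K"
proof -
  have "0 \<le> K * exp (- (0\<^sup>2 / 72))"
    by (rule order_trans[OF measure_nonneg tail[of 0 0 "max 1 (\<phi> 0)" 0]]) auto
  then show ?thesis by simp
qed

text \<open>
  The number of pairs at level \<open>r\<close> is \<open>2 ^ (k + 1)\<close> with \<open>k = n - r\<close>, and the threshold, with
  \<open>288 = 4 * 72\<close>, makes each exceptional event have probability \<open>O(n ^ (- 4 k))\<close>. So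
  the union over all levels has probability \<open>O(n ^ (- 2))\<close>, and the Borel-Cantelli lemma applies.
\<close>

lemma AE_dyadic_increments:
  assumes V: "\<And>n r. N \<le> n \<Longrightarrow> r < n \<Longrightarrow> 0 < V n r \<and> \<phi> (2 ^ r) \<le> V n r"
  shows "AE \<omega> in M. \<forall>\<^sub>F n in sequentially. \<forall>r<n. \<forall>i<2 ^ Suc (n - r).
    \<bar>Z (real i * 2 ^ r) \<omega> - Z (real (Suc i) * 2 ^ r) \<omega>\<bar>
      \<le> V n r * sqrt (288 * real (n - r) * ln (real n))"
proof -
  define A where "A n r i = {\<omega> \<in> space M. V n r * sqrt (288 * real (n - r) * ln (real n))
    < \<bar>Z (real i * 2 ^ r) \<omega> - Z (real (Suc i) * 2 ^ r) \<omega>\<bar>}" for n r i :: nat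
  define B where "B n = (\<Union>r<n. \<Union>i<2 ^ Suc (n - r). A n r i)" for n
  have A [measurable]: "A n r i \<in> sets M" for n r i
    unfolding A_def by (intro sets_increment) auto
  have "prob (B n) \<le> 2 * K * (1 / real n ^ 2)" if n: "max 2 N \<le> n" for n
  proof -
    have ln: "0 \<le> ln (real n)" using n by simp
    have A_le: "prob (A n r i) \<le> K * ((1/4) ^ (n - r) * (1 / real n ^ 2))" if r: "r < n" for r i
    proof -
      define k where "k = n - r"
      have k: "1 \<le> k" using r by (simp add: k_def)
      have dist: "\<bar>real (Suc i) * 2 ^ r - real i * 2 ^ r\<bar> = 2 ^ r" by (simp add: algebra_simps)
      have "prob (A n r i) \<le> K * exp (- ((sqrt (288 * real (n - r) * ln (real n)))\<^sup>2 / 72))"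
        unfolding A_def using V[of n r] n r ln dist by (intro tail) auto
      also have "(sqrt (288 * real (n - r) * ln (real n)))\<^sup>2 / 72 = (4 * real k) * ln (real n)"
        using ln by (simp add: k_def)
      also have "exp (- ((4 * real k) * ln (real n))) = (1 / real n) ^ (4 * k)"
        using n exp_of_nat_mult[of "4 * k" "- ln (real n)"] by (simp add: exp_minus inverse_eq_divide)
      also have "(1 / real n) ^ (4 * k) \<le> (1/4) ^ k * (1 / real n ^ 2)"
      proof -
        have "(1 / real n) ^ (4 * k) = ((1 / real n) ^ 2) ^ k * (1 / real n) ^ (2 * k)"
          by (simp add: power_mult[symmetric] power_add[symmetric])
        also have "\<dots> \<le> (1/4) ^ k * (1 / real n) ^ 2"
        proof (intro mult_mono power_mono power_decreasing)
          have "(1 / real n)\<^sup>2 \<le> (1/2)\<^sup>2" using n by (intro power_mono) (auto simp: field_simps)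
          then show "(1 / real n)\<^sup>2 \<le> 1/4" by (simp add: power2_eq_square)
        qed (use k n in auto)
        finally show ?thesis by (simp add: power_divide)
      qed
      finally show ?thesis using K_nonneg by (simp add: k_def mult_left_mono)
    qed
    have "prob (B n) \<le> (\<Sum>r<n. prob (\<Union>i<2 ^ Suc (n - r). A n r i))"
      unfolding B_def by (intro finite_measure_subadditive_finite) auto
    also have "\<dots> \<le> (\<Sum>r<n. \<Sum>i<2 ^ Suc (n - r). prob (A n r i))"
      by (intro sum_mono finite_measure_subadditive_finite) auto
    also have "\<dots> \<le> (\<Sum>r<n. \<Sum>i<(2::nat) ^ Suc (n - r). K * ((1/4) ^ (n - r) * (1 / real n ^ 2)))"
      by (intro sum_mono A_le) auto
    also have "\<dots> = 2 * K * (1 / real n ^ 2) * (\<Sum>r<n. (1/2) ^ (n - r))"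
    proof -
      have "(2::real) ^ (n - r) * (1/4) ^ (n - r) = (1/2) ^ (n - r)" for r
        by (simp flip: power_mult_distrib)
      then show ?thesis by (simp add: sum_distrib_left mult_ac)
    qed
    also have "(\<Sum>r<n. (1/2) ^ (n - r)) \<le> (1::real)"
    proof -
      have "(\<Sum>r<n. (1/2) ^ (n - r)) = (\<Sum>r<n. (1/2::real) ^ Suc (n - Suc r))"
        by (intro sum.cong) (auto simp: Suc_diff_Suc)
      also have "\<dots> = (\<Sum>r<n. (1/2) ^ Suc r)"
        by (rule sum.nat_diff_reindex)
      also have "\<dots> \<le> (\<Sum>r. (1/2) ^ Suc r)"
        by (intro sum_le_suminf) (auto intro!: summable_geometric simp: summable_Suc_iff)
      also have "\<dots> = (1::real)" using power_half_series by (simp add: sums_iff)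
      finally show ?thesis .
    qed
    then have "2 * K * (1 / real n ^ 2) * (\<Sum>r<n. (1/2) ^ (n - r)) \<le> 2 * K * (1 / real n ^ 2) * 1"
      using K_nonneg by (intro mult_left_mono) auto
    finally show ?thesis by simp
  qed
  moreover have "summable (\<lambda>n. 2 * K * (1 / real n ^ 2))"
    using inverse_power_summable[of 2, where 'a=real] by (intro summable_mult) (simp add: inverse_eq_divide)
  moreover have "B n \<in> sets M" for n unfolding B_def by measurable
  ultimately have "AE \<omega> in M. \<forall>\<^sub>F n in sequentially. \<omega> \<notin> B n"
    by (intro AE_eventually_notin[of B _ "max 2 N"]) auto
  then show ?thesis
    using AE_space
  proof eventually_elim
    case (elim \<omega>)
    from elim(1) show ?case
      by (rule eventually_mono) (use elim(2) in \<open>auto simp: B_def A_def not_less\<close>)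
  qed
qed

text \<open>
  Chaining inside a unit interval \<open>[j, j + 1)\<close> along grids of mesh \<open>g k = 2 / 2 ^ 2 ^ k\<close>, which start with
  the single point \<open>j\<close>. The approximations of \<open>t\<close> by consecutive grids differ by at most \<open>g k\<close>, and
  there are at most \<open>exp (3 * 2 ^ k)\<close> pairs of grid points to control. A threshold
  \<open>v k * sqrt (288 * (2 ^ k + ln j))\<close> beats this number and leaves a factor \<open>1 / j\<^sup>2\<close> for the
  Borel-Cantelli lemma. Continuity carries the bound from the grids to all \<open>t\<close>.
\<close>

lemma AE_local_oscillation:
  fixes v :: "nat \<Rightarrow> real"
  assumes v: "\<And>k. 0 < v k" "\<And>k. \<phi> (2 / 2 ^ 2 ^ k) \<le> v k" and mono: "mono_on {0..} \<phi>"
    and sum: "summable (\<lambda>k. sqrt (2 ^ k) * v k)"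
    and cont: "AE \<omega> in M. continuous_on {0..} (\<lambda>t. Z t \<omega>)"
  shows "AE \<omega> in M. \<forall>\<^sub>F j in sequentially. \<forall>t. real j \<le> t \<and> t < real j + 1 \<longrightarrow>
    \<bar>Z t \<omega> - Z (real j) \<omega>\<bar> \<le> (\<Sum>k. sqrt (2 ^ k) * v k) * sqrt (288 * (1 + ln (real j)))"
proof -
  define g where "g k = (2 / 2 ^ 2 ^ k :: real)" for k :: nat
  define m where "m k = (2 ^ (2 ^ k - 1) :: nat)" for k :: nat
  have g_pos: "0 < g k" for k by (simp add: g_def)
  have gm: "g k * real (m k) = 1" for k
  proof -
    have "(2::real) ^ 2 ^ k = 2 * 2 ^ (2 ^ k - 1)"
      by (subst power_Suc[symmetric]) simp
    then show ?thesis by (simp add: g_def m_def)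
  qed
  have g_mono: "g (Suc k) \<le> g k" for k
    by (auto simp: g_def field_simps intro!: power_increasing)
  have card: "real (m (Suc k)) * real (m k) \<le> exp (3 * 2 ^ k)" for k
  proof -
    have "real (m (Suc k)) * real (m k) = 2 ^ (2 ^ Suc k - 1 + (2 ^ k - 1))"
      unfolding m_def power_add by simp
    also have "\<dots> \<le> 2 ^ (3 * 2 ^ k)"
      by (intro power_increasing) auto
    also have "\<dots> \<le> exp 1 ^ (3 * 2 ^ k)"
      using exp_ge_add_one_self[of 1] by (intro power_mono) auto
    finally show ?thesis by (simp flip: exp_of_nat_mult)
  qed
  define D where "D k j = v k * sqrt (288 * (2 ^ k + ln (real j)))" for k j :: nat
  define A where "A j k i i' = {\<omega> \<in> space M. D k j
      < \<bar>Z (real j + real i * g (Suc k)) \<omega> - Z (real j + real i' * g k) \<omega>\<bar>}" for j k i i' :: nat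
  define I where "I k = {(i, i'). i < m (Suc k) \<and> i' < m k \<and> \<bar>real i' * g k - real i * g (Suc k)\<bar> \<le> g k}" for k
  define B where "B j k = (\<Union>p\<in>I k. A j k (fst p) (snd p))" for j k
  have I_sub: "I k \<subseteq> {..<m (Suc k)} \<times> {..<m k}" for k by (auto simp: I_def)
  then have I_fin: "finite (I k)" for k by (rule finite_subset) simp
  have I_card: "real (card (I k)) \<le> exp (3 * 2 ^ k)" for k
  proof -
    have "card (I k) \<le> card ({..<m (Suc k)} \<times> {..<m k})"
      by (rule card_mono[OF _ I_sub]) simp
    then have "real (card (I k)) \<le> real (m (Suc k)) * real (m k)"
      by (simp flip: of_nat_mult)
    with card[of k] show ?thesis by simp
  qed
  have A_sets [measurable]: "A j k i i' \<in> sets M" for j k i i'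
    unfolding A_def using g_pos[of k] g_pos[of "Suc k"] by (intro sets_increment) auto
  have B_sets [measurable]: "B j k \<in> sets M" for j k
    unfolding B_def using I_fin by (intro sets.finite_UN) auto
  have B_le: "prob (B j k) \<le> K * (1 / real j ^ 2) * (1/2) ^ k" if j: "1 \<le> j" for j k
  proof -
    have ln: "0 \<le> ln (real j)" using j by simp
    have "prob (B j k) \<le> (\<Sum>p\<in>I k. prob (A j k (fst p) (snd p)))"
      unfolding B_def by (intro finite_measure_subadditive_finite) (auto simp: I_fin)
    also have "\<dots> \<le> (\<Sum>p\<in>I k. K * exp (- (4 * (2 ^ k + ln (real j)))))"
    proof (rule sum_mono)
      fix p assume p: "p \<in> I k"
      have "\<phi> \<bar>(real j + real (snd p) * g k) - (real j + real (fst p) * g (Suc k))\<bar> \<le> \<phi> (g k)"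
        using p g_pos[of k] by (intro mono_onD[OF mono]) (auto simp: I_def)
      also have "\<dots> \<le> v k" using v(2) by (simp add: g_def)
      finally have "prob (A j k (fst p) (snd p)) \<le> K * exp (- ((sqrt (288 * (2 ^ k + ln (real j))))\<^sup>2 / 72))"
        unfolding A_def D_def using v(1)[of k] ln g_pos[of k] g_pos[of "Suc k"] by (intro tail) auto
      also have "(sqrt (288 * (2 ^ k + ln (real j))))\<^sup>2 / 72 = 4 * (2 ^ k + ln (real j))"
        using ln by simp
      finally show "prob (A j k (fst p) (snd p)) \<le> K * exp (- (4 * (2 ^ k + ln (real j))))" .
    qed
    also have "\<dots> = real (card (I k)) * (K * exp (- (4 * (2 ^ k + ln (real j)))))" by simp
    also have "\<dots> \<le> exp (3 * 2 ^ k) * (K * exp (- (4 * (2 ^ k + ln (real j)))))"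
      using I_card K_nonneg by (intro mult_right_mono) auto
    also have "\<dots> = K * (exp (- (4 * ln (real j))) * exp (- (2 ^ k)))"
      by (simp add: exp_add[symmetric])
    also have "\<dots> \<le> K * ((1 / real j ^ 2) * (1/2) ^ k)"
    proof (intro mult_left_mono mult_mono K_nonneg)
      have "exp (- (4 * ln (real j))) = (1 / real j) ^ 4"
        using j exp_of_nat_mult[of 4 "- ln (real j)"] by (simp add: exp_minus inverse_eq_divide)
      also have "\<dots> \<le> (1 / real j) ^ 2" using j by (intro power_decreasing) auto
      finally show "exp (- (4 * ln (real j))) \<le> 1 / real j ^ 2" by (simp add: power_divide)
      have "(2::real) ^ k \<le> exp 1 ^ 2 ^ k"
      proof -
        have "(2::real) ^ k \<le> 2 ^ 2 ^ k" by (intro power_increasing) auto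
        also have "\<dots> \<le> exp 1 ^ 2 ^ k" using exp_ge_add_one_self[of 1] by (intro power_mono) auto
        finally show ?thesis .
      qed
      then have "2 ^ k \<le> exp (2 ^ k :: real)" by (simp flip: exp_of_nat_mult)
      then show "exp (- (2 ^ k :: real)) \<le> (1/2) ^ k"
        by (simp add: exp_minus power_divide field_simps)
    qed auto
    finally show ?thesis by (simp add: mult_ac)
  qed
  have BU: "prob (\<Union>k. B j k) \<le> 2 * K * (1 / real j ^ 2)" if j: "1 \<le> j" for j
  proof -
    have geo: "(\<lambda>k. K * (1 / real j ^ 2) * (1/2) ^ k) sums (K * (1 / real j ^ 2) * 2)"
      using geometric_sums[of "1/2 :: real"] by (intro sums_mult) simp
    have s: "summable (\<lambda>k. prob (B j k))"
      by (rule summable_comparison_test'[OF sums_summable[OF geo], of 0]) (use B_le[OF j] in simp)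
    have "prob (\<Union>k. B j k) \<le> (\<Sum>k. prob (B j k))"
      by (intro finite_measure_subadditive_countably s) auto
    also have "\<dots> \<le> (\<Sum>k. K * (1 / real j ^ 2) * (1/2) ^ k)"
      by (intro suminf_le B_le[OF j] s sums_summable[OF geo])
    also have "\<dots> = K * (1 / real j ^ 2) * 2" using geo by (simp add: sums_iff)
    finally show ?thesis by (simp add: mult_ac)
  qed
  moreover have "summable (\<lambda>n. 2 * K * (1 / real n ^ 2))"
    using inverse_power_summable[of 2, where 'a=real] by (intro summable_mult) (simp add: inverse_eq_divide)
  ultimately have "AE \<omega> in M. \<forall>\<^sub>F j in sequentially. \<omega> \<notin> (\<Union>k. B j k)"
    by (intro AE_eventually_notin[of "\<lambda>j. \<Union>k. B j k" _ 1]) auto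
  then show ?thesis
    using AE_space cont
  proof eventually_elim
    case (elim \<omega>)
    have "\<forall>\<^sub>F j in sequentially. 1 \<le> j" by (rule eventually_ge_at_top)
    with elim(1) show ?case
    proof eventually_elim
      case (elim j)
      have ln: "0 \<le> ln (real j)" using elim by simp
      show ?case
      proof (intro allI impI)
        fix t assume t: "real j \<le> t \<and> t < real j + 1"
        define i where "i k = nat \<lfloor>(t - real j) / g k\<rfloor>" for k
        define s where "s k = real j + real (i k) * g k" for k
        have i_le: "real (i k) \<le> (t - real j) / g k" and i_gt: "(t - real j) / g k < real (i k) + 1" for k
          using t g_pos[of k] by (auto simp: i_def of_nat_nat intro: of_int_floor_le)
        have s: "s k \<le> t" "t - g k < s k" "0 \<le> s k" for k
          using i_le[of k] i_gt[of k] g_pos[of k] by (auto simp: s_def field_simps)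
        have im: "i k < m k" for k
        proof -
          have "real (i k) * g k < real (m k) * g k"
            using i_le[of k] g_pos[of k] t gm[of k] by (simp add: field_simps)
          then show ?thesis using g_pos[of k] by simp
        qed
        have step: "\<bar>Z (s (Suc k)) \<omega> - Z (s k) \<omega>\<bar> \<le> sqrt (2 ^ k) * v k * sqrt (288 * (1 + ln (real j)))" for k
        proof -
          have "(i (Suc k), i k) \<in> I k"
            using im s[of k] s[of "Suc k"] g_mono[of k] by (auto simp: I_def s_def abs_le_iff)
          moreover have "\<omega> \<notin> B j k" using elim by auto
          ultimately have "\<omega> \<notin> A j k (i (Suc k)) (i k)" unfolding B_def by force
          then have "\<bar>Z (s (Suc k)) \<omega> - Z (s k) \<omega>\<bar> \<le> D k j"
            using \<open>\<omega> \<in> space M\<close> by (simp add: A_def s_def not_less)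
          also have "2 ^ k + ln (real j) \<le> 2 ^ k * (1 + ln (real j))"
            using ln mult_right_mono[of 1 "2 ^ k" "ln (real j)"] by (simp add: algebra_simps)
          then have "D k j \<le> v k * sqrt (288 * (2 ^ k * (1 + ln (real j))))"
            unfolding D_def using v(1)[of k] by (intro mult_left_mono real_sqrt_le_mono) auto
          also have "\<dots> = sqrt (2 ^ k) * v k * sqrt (288 * (1 + ln (real j)))"
            by (simp only: real_sqrt_mult mult_ac)
          finally show ?thesis .
        qed
        have s0: "s 0 = real j"
          using im[of 0] by (simp add: s_def m_def)
        have partial: "\<bar>Z (s n) \<omega> - Z (real j) \<omega>\<bar> \<le> (\<Sum>k. sqrt (2 ^ k) * v k) * sqrt (288 * (1 + ln (real j)))" for n
        proof -
          have "Z (s n) \<omega> - Z (real j) \<omega> = (\<Sum>k<n. Z (s (Suc k)) \<omega> - Z (s k) \<omega>)"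
            using sum_lessThan_telescope[of "\<lambda>k. Z (s k) \<omega>" n] by (simp add: s0)
          also have "\<bar>\<dots>\<bar> \<le> (\<Sum>k<n. sqrt (2 ^ k) * v k * sqrt (288 * (1 + ln (real j))))"
            by (rule order_trans[OF sum_abs sum_mono[OF step]])
          also have "\<dots> = (\<Sum>k<n. sqrt (2 ^ k) * v k) * sqrt (288 * (1 + ln (real j)))"
            by (simp add: sum_distrib_right)
          also have "\<dots> \<le> (\<Sum>k. sqrt (2 ^ k) * v k) * sqrt (288 * (1 + ln (real j)))"
            using ln v(1) by (intro mult_right_mono sum_le_suminf sum) (auto intro: less_imp_le)
          finally show ?thesis .
        qed
        have g_lim: "g \<longlonglongrightarrow> 0"
        proof (rule real_tendsto_sandwich[of "\<lambda>_. 0"])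
          show "\<forall>\<^sub>F k in sequentially. g k \<le> 2 * (1/2) ^ k"
            by (rule always_eventually) (auto simp: g_def power_divide field_simps intro!: power_increasing)
          show "(\<lambda>k. 2 * (1/2) ^ k) \<longlonglongrightarrow> (0::real)"
            by (intro tendsto_mult_right_zero LIMSEQ_power_zero) simp
        qed (auto intro!: always_eventually less_imp_le g_pos)
        have "s \<longlonglongrightarrow> t"
        proof (rule real_tendsto_sandwich[of "\<lambda>k. t - g k" s sequentially "\<lambda>_. t"])
          show "(\<lambda>k. t - g k) \<longlonglongrightarrow> t" using tendsto_diff[OF tendsto_const g_lim, of t] by simp
          show "\<forall>\<^sub>F k in sequentially. t - g k \<le> s k" "\<forall>\<^sub>F k in sequentially. s k \<le> t"
            using s by (auto intro!: always_eventually intro: less_imp_le)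
        qed simp
        then have "(\<lambda>n. Z (s n) \<omega>) \<longlonglongrightarrow> Z t \<omega>"
          using \<open>continuous_on {0..} (\<lambda>t. Z t \<omega>)\<close> t s(3)
          by (intro continuous_on_tendsto_compose[of "{0..}" "\<lambda>t. Z t \<omega>" s]) auto
        then have "(\<lambda>n. \<bar>Z (s n) \<omega> - Z (real j) \<omega>\<bar>) \<longlonglongrightarrow> \<bar>Z t \<omega> - Z (real j) \<omega>\<bar>"
          by (intro tendsto_intros)
        then show "\<bar>Z t \<omega> - Z (real j) \<omega>\<bar> \<le> (\<Sum>k. sqrt (2 ^ k) * v k) * sqrt (288 * (1 + ln (real j)))"
          by (rule LIMSEQ_le_const2) (use partial in auto)
      qed
    qed
  qed
qed

end

section \<open>From dyadic blocks to the limit superior\<close>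

text \<open>
  Rounding \<open>t\<close> down to successive multiples of \<open>2 ^ r\<close> moves it by \<open>0\<close> or by one step
  \<open>2 ^ r\<close> between adjacent grid points, according to the binary digit of \<open>t\<close> in place \<open>r\<close>.
\<close>

lemma dyadic_chain_bound:
  fixes z :: "nat \<Rightarrow> real" and b :: "nat \<Rightarrow> real"
  assumes b: "\<And>r. r < n \<Longrightarrow> 0 \<le> b r"
    and inc: "\<And>r i. r < n \<Longrightarrow> i < 2 ^ Suc (n - r) \<Longrightarrow> \<bar>z (i * 2 ^ r) - z (Suc i * 2 ^ r)\<bar> \<le> b r"
    and t: "t < 2 ^ Suc n" and k: "k \<le> n"
  shows "\<bar>z t - z (t div 2 ^ k * 2 ^ k)\<bar> \<le> (\<Sum>r<k. b r)"
  using k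
proof (induction k)
  case (Suc k)
  then have r: "k < n" by simp
  define i where "i = 2 * (t div 2 ^ Suc k)"
  have i: "t div 2 ^ Suc k * 2 ^ Suc k = i * 2 ^ k" by (simp add: i_def)
  have half: "t div 2 ^ Suc k = t div 2 ^ k div 2" by (simp only: power_Suc2 div_mult2_eq)
  then have or: "t div 2 ^ k = i \<or> t div 2 ^ k = Suc i" unfolding i_def by linarith
  have "t div 2 ^ k < 2 ^ Suc (n - k)"
  proof (rule div_less_iff_less_mult[THEN iffD2])
    have "(2::nat) ^ Suc (n - k) * 2 ^ k = 2 ^ Suc n" using r by (simp flip: power_add)
    then show "t < 2 ^ Suc (n - k) * 2 ^ k" using t by simp
  qed simp
  then have "i < 2 ^ Suc (n - k)" using or by auto
  from inc[OF r this] have "\<bar>z (t div 2 ^ k * 2 ^ k) - z (t div 2 ^ Suc k * 2 ^ Suc k)\<bar> \<le> b k"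
    unfolding i using or b[OF r] by (auto simp: abs_minus_commute)
  with Suc.IH r show ?case by (simp add: abs_le_iff)
qed simp

text \<open>
  Only this step determines the constant \<open>1\<close> in the theorem: at the \<open>2 ^ m\<close> block starts
  between \<open>2 ^ n\<close> and \<open>2 ^ (n + 1)\<close> the gamma tail at height \<open>(1 + \<delta>) ln n\<close> is
  \<open>O(n powr (- \<kappa>))\<close> with \<open>\<kappa> > 1\<close>.
\<close>

lemma AE_grid_margins:
  fixes X :: "real \<Rightarrow> 'a \<Rightarrow> real"
  assumes ps: "prob_space M" and perm: "permanental_process M \<alpha> {0..} u X"
    and pos: "\<forall>\<^sub>F t in at_top. 0 < u t t" and \<delta>: "0 < \<delta>"
  shows "AE \<omega> in M. \<forall>\<^sub>F n in sequentially. \<forall>i\<in>{2 ^ m..<2 ^ Suc m}.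
    X (real i * 2 ^ (n - m)) \<omega> \<le> u (real i * 2 ^ (n - m)) (real i * 2 ^ (n - m)) * ((1 + \<delta>) * ln (real n))"
proof -
  interpret prob_space M by (rule ps)
  define \<tau> where "\<tau> i n = real i * 2 ^ (n - m)" for i n :: nat
  define A where "A n i = {\<omega> \<in> space M. u (\<tau> i n) (\<tau> i n) * ((1 + \<delta>) * ln (real n)) < X (\<tau> i n) \<omega>}" for n i
  define B where "B n = (\<Union>i\<in>{2 ^ m..<2 ^ Suc m}. A n i)" for n
  have [measurable]: "X (\<tau> i n) \<in> borel_measurable M" for i n
    by (rule permanental_margin(1)[OF ps perm]) (simp add: \<tau>_def)
  have A [measurable]: "A n i \<in> sets M" for n i unfolding A_def by measurable
  \<comment> \<open>Any exponent in \<open>(1 / (1 + \<delta>), 1)\<close> works: below the pole at \<open>1\<close>, and giving \<open>\<kappa> > 1\<close>.\<close>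
  define p where "p = 1 / (1 + \<delta> / 2)"
  have p: "0 \<le> p" "p < 1" using \<delta> by (auto simp: p_def)
  define \<kappa> where "\<kappa> = p * (1 + \<delta>)"
  have \<kappa>: "1 < \<kappa>" using \<delta> by (simp add: \<kappa>_def p_def field_simps)
  obtain a where a: "\<And>t. a \<le> t \<Longrightarrow> 0 < u t t" using pos by (auto simp: eventually_at_top_linorder)
  have "\<forall>\<^sub>F n in sequentially. a \<le> 2 ^ n"
    using filterlim_power2_at_top by (simp add: filterlim_at_top)
  then obtain N where N: "\<And>n. N \<le> n \<Longrightarrow> a \<le> 2 ^ n" by (auto simp: eventually_sequentially)
  define c where "c = 2 ^ m * (1 - p) powr (- \<alpha>)"
  have le: "prob (B n) \<le> c * real n powr (- \<kappa>)" if n: "1 \<le> n" "m \<le> n" "N \<le> n" for n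
  proof -
    have "prob (A n i) \<le> (1 - p) powr (- \<alpha>) * real n powr (- \<kappa>)" if i: "i \<in> {2 ^ m..<2 ^ Suc m}" for i
    proof -
      have "(2::real) ^ n = 2 ^ m * 2 ^ (n - m)" using n(2) by (simp flip: power_add)
      also have "\<dots> \<le> \<tau> i n"
      proof -
        have "real (2 ^ m) \<le> real i" using i by (intro of_nat_mono) simp
        then show ?thesis unfolding \<tau>_def by (intro mult_right_mono) simp_all
      qed
      finally have "2 ^ n \<le> \<tau> i n" .
      from order_trans[OF N[OF n(3)] \<open>2 ^ n \<le> \<tau> i n\<close>] have "a \<le> \<tau> i n" .
      then have u: "0 < u (\<tau> i n) (\<tau> i n)" by (rule a)
      have "prob (A n i) \<le> (1 - p) powr (- \<alpha>) * exp (- (p * ((1 + \<delta>) * ln (real n))))"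
        unfolding A_def using u p by (intro margin_tail[OF ps perm]) (auto simp: \<tau>_def)
      also have "exp (- (p * ((1 + \<delta>) * ln (real n)))) = real n powr (- \<kappa>)"
        using n by (simp add: powr_def \<kappa>_def)
      finally show ?thesis .
    qed
    then have "(\<Sum>i\<in>{2 ^ m..<2 ^ Suc m}. prob (A n i))
      \<le> (\<Sum>i\<in>{(2::nat) ^ m..<2 ^ Suc m}. (1 - p) powr (- \<alpha>) * real n powr (- \<kappa>))"
      by (intro sum_mono)
    moreover have "prob (B n) \<le> (\<Sum>i\<in>{2 ^ m..<2 ^ Suc m}. prob (A n i))"
      unfolding B_def by (intro finite_measure_subadditive_finite) auto
    ultimately show ?thesis by (simp add: c_def mult.assoc)
  qed
  have "summable (\<lambda>n. c * real n powr (- \<kappa>))"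
    using \<kappa> by (intro summable_mult) (simp add: summable_real_powr_iff)
  moreover have "B n \<in> sets M" for n unfolding B_def by (intro sets.finite_UN) auto
  ultimately have "AE \<omega> in M. \<forall>\<^sub>F n in sequentially. \<omega> \<notin> B n"
    by (intro AE_eventually_notin[of B "\<lambda>n. c * real n powr (- \<kappa>)" "max 1 (max m N)"] le) simp_all
  then show ?thesis
    using AE_space
  proof eventually_elim
    case (elim \<omega>)
    from elim(1) show ?case
      by (rule eventually_mono) (use elim(2) in \<open>auto simp: B_def A_def \<tau>_def not_less\<close>)
  qed
qed

text \<open>
  Refining the blocks, that is, enlarging \<open>m\<close>, makes the chaining sum from a block start to the
  integers of its block small, uniformly in \<open>n\<close>.
\<close>

lemma summable_times_power_tail:
  fixes q c \<delta> :: real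
  assumes q: "0 \<le> q" "q < 1" and "0 \<le> c" "0 < \<delta>"
  obtains m where "\<And>n. m \<le> n \<Longrightarrow> c * (\<Sum>r<n - m. real (n - r) * q ^ (n - r)) \<le> \<delta>" "c * q ^ m \<le> \<delta>"
proof -
  define f where "f k = real k * q ^ k" for k
  have sf: "summable f"
  proof -
    have "summable (\<lambda>n. diffs (\<lambda>_. 1) n * q ^ n)"
      by (rule termdiff_converges[of q 1]) (use q in \<open>auto intro: summable_geometric\<close>)
    then have "summable (\<lambda>n. q * (real (Suc n) * q ^ n))"
      by (intro summable_mult) (simp add: diffs_def)
    then have "summable (\<lambda>n. f (Suc n))" by (simp add: f_def mult_ac)
    then show ?thesis by (simp add: summable_Suc_iff)
  qed
  have f0: "0 \<le> f k" for k using q by (simp add: f_def)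
  have "(\<lambda>m. c * (\<Sum>k. f (k + Suc m))) \<longlonglongrightarrow> 0"
    using suminf_exist_split2[OF sf] by (intro tendsto_mult_right_zero LIMSEQ_Suc)
  moreover have "(\<lambda>m. c * q ^ m) \<longlonglongrightarrow> 0"
    using q by (intro tendsto_mult_right_zero LIMSEQ_power_zero) auto
  ultimately have "\<forall>\<^sub>F m in sequentially. c * (\<Sum>k. f (k + Suc m)) < \<delta> \<and> c * q ^ m < \<delta>"
    using \<open>0 < \<delta>\<close> by (intro eventually_conj order_tendstoD(2)) auto
  then obtain m where m: "c * (\<Sum>k. f (k + Suc m)) < \<delta>" "c * q ^ m < \<delta>"
    by (auto simp: eventually_sequentially)
  show ?thesis
  proof
    fix n assume "m \<le> n"
    have "(\<Sum>r<n - m. f (n - r)) = (\<Sum>r<n - m. f ((n - m - Suc r) + Suc m))"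
      by (intro sum.cong) (auto simp: Suc_diff_Suc)
    also have "\<dots> = (\<Sum>r<n - m. f (r + Suc m))" by (rule sum.nat_diff_reindex)
    also have "\<dots> \<le> (\<Sum>k. f (k + Suc m))"
      using f0 sf by (intro sum_le_suminf) (auto simp: summable_iff_shift[of f "Suc m", simplified])
    finally have "c * (\<Sum>r<n - m. f (n - r)) \<le> c * (\<Sum>k. f (k + Suc m))"
      using \<open>0 \<le> c\<close> by (rule mult_left_mono)
    with m show "c * (\<Sum>r<n - m. real (n - r) * q ^ (n - r)) \<le> \<delta>" by (simp add: f_def)
  qed (use m in simp)
qed

text \<open>
  The pathwise estimate on \<open>[2 ^ n, 2 ^ (n + 1))\<close>. Let \<open>s\<close> be the last multiple of
  \<open>2 ^ (n - m)\<close> up to \<open>t\<close>. The path is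
  compared at \<open>s\<close>, at the integer part \<open>j\<close> of \<open>t\<close> and at \<open>t\<close>: the margin bound holds at \<open>s\<close>, the
  dyadic chain leads from \<open>s\<close> to \<open>j\<close>, and the local oscillation from \<open>j\<close> to \<open>t\<close>. Each of the
  two moves costs at most \<open>\<delta> sqrt (U s * ln n)\<close>, while \<open>U t\<close> cannot be much smaller than \<open>U s\<close>.
  The witness \<open>w\<close> is \<open>U s * ln n\<close>.
\<close>

lemma dyadic_block_estimate:
  fixes z U :: "real \<Rightarrow> real" and \<phi> :: "real \<Rightarrow> real"
  assumes \<delta>: "0 < \<delta>" "\<delta> < 1" and q: "0 \<le> q" and C: "0 \<le> C"
    and U: "\<And>t. 0 \<le> t \<Longrightarrow> 0 \<le> U t"
    and sig: "\<And>s t. 0 \<le> s \<Longrightarrow> 0 \<le> t \<Longrightarrow> \<bar>sqrt (U s) - sqrt (U t)\<bar> \<le> \<phi> \<bar>t - s\<bar>"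
    and mono: "mono_on {0..} \<phi>"
    and n: "m \<le> n" "3 \<le> n"
    and pos: "0 < U (2 ^ n)"
    and dom: "\<phi> (2 ^ (n - m)) \<le> C * sqrt (U (2 ^ n)) * q ^ m"
    and comp: "\<And>i. i \<in> {2 ^ m..<2 ^ Suc m} \<Longrightarrow> U (2 ^ n) / 4 < U (real i * 2 ^ (n - m))"
    and inc: "\<And>r i. r < n \<Longrightarrow> i < 2 ^ Suc (n - r) \<Longrightarrow>
      \<bar>z (real i * 2 ^ r) - z (real (Suc i) * 2 ^ r)\<bar>
        \<le> C * sqrt (U (2 ^ n)) * q ^ (n - r) * sqrt (288 * real (n - r) * ln (real n))"
    and osc: "\<And>j t. 2 ^ n \<le> j \<Longrightarrow> real j \<le> t \<and> t < real j + 1 \<Longrightarrow>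
      \<bar>z t - z (real j)\<bar> \<le> L * sqrt (288 * (1 + ln (real j)))"
    and margin: "\<And>i. i \<in> {2 ^ m..<2 ^ Suc m} \<Longrightarrow>
      z (real i * 2 ^ (n - m)) \<le> sqrt (U (real i * 2 ^ (n - m)) * ((1 + \<delta>) * ln (real n)))"
    and L: "0 \<le> L" "L * sqrt (288 * (real n + 2)) \<le> \<delta> / 2 * sqrt (U (2 ^ n))"
    and m: "2 * C * sqrt 288 * (\<Sum>r<n - m. real (n - r) * q ^ (n - r)) \<le> \<delta>" "2 * C * sqrt 288 * q ^ m \<le> \<delta>"
    and lnln: "(1 - \<delta>) * ln (real n) \<le> ln (real n * ln 2)"
    and t: "2 ^ n \<le> t" "t < 2 ^ Suc n"
  shows "\<exists>w>0. (z t \<le> 0 \<or> (z t)\<^sup>2 \<le> (1 + 3 * \<delta>)\<^sup>2 * w) \<and> (1 - \<delta>) ^ 3 * w \<le> U t * ln (ln t)"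
proof -
  define j where "j = nat \<lfloor>t\<rfloor>"
  have "(1::real) \<le> 2 ^ n" by simp
  then have t1: "1 \<le> t" using t by linarith
  have j: "real j \<le> t" "t < real j + 1" using t1 by (auto simp: j_def of_nat_nat intro: of_int_floor_le)
  have jn: "2 ^ n \<le> j" "j < 2 ^ Suc n"
  proof -
    have "(2::int) ^ n \<le> \<lfloor>t\<rfloor>" using t by (simp add: le_floor_iff)
    then have "nat (2 ^ n) \<le> j" unfolding j_def by (rule nat_mono)
    then show "2 ^ n \<le> j" by (simp add: nat_power_eq)
    have "real j < real (2 ^ Suc n)" using j t by simp
    then show "j < 2 ^ Suc n" by (simp only: of_nat_less_iff)
  qed
  define k where "k = n - m"
  have nk: "n = m + k" "k \<le> n" using n by (auto simp: k_def)
  define i where "i = j div 2 ^ k"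
  have i: "i \<in> {2 ^ m..<2 ^ Suc m}"
  proof -
    have "2 ^ m * 2 ^ k \<le> j" "j < 2 ^ Suc m * 2 ^ k"
      using jn by (simp_all add: nk(1) power_add mult_ac)
    then show ?thesis
      unfolding i_def by (auto simp: less_eq_div_iff_mult_less_eq div_less_iff_less_mult)
  qed
  define s where "s = real i * 2 ^ k"
  define G where "G = sqrt (U (2 ^ n))"
  define S where "S = sqrt (U s)"
  define l where "l = sqrt (ln (real n))"
  have s0: "0 \<le> s" by (simp add: s_def)
  have G: "0 < G" using pos by (simp add: G_def)
  have "ln (exp 1) \<le> ln (real n)"
    using n exp_le by (subst ln_le_cancel_iff) auto
  then have ln1: "1 \<le> ln (real n)" by simp
  then have l: "1 \<le> l" "l\<^sup>2 = ln (real n)" by (auto simp: l_def)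
  have GS: "G \<le> 2 * S"
  proof -
    have "G\<^sup>2 \<le> (2 * S)\<^sup>2" using comp[OF i] pos U[OF s0] by (simp add: G_def S_def s_def k_def power_mult_distrib)
    then show ?thesis by (rule power2_le_imp_le) (simp add: S_def U[OF s0])
  qed
  have S: "0 < S" using G GS by linarith
  have step1: "\<bar>z (real j) - z s\<bar> \<le> \<delta> * S * l"
  proof -
    define b where "b r = C * G * q ^ (n - r) * sqrt (288 * real (n - r) * ln (real n))" for r
    have "\<bar>z (real j) - z (real (j div 2 ^ k * 2 ^ k))\<bar> \<le> (\<Sum>r<k. b r)"
    proof (rule dyadic_chain_bound[where z = "\<lambda>j. z (real j)" and n = n])
      show "0 \<le> b r" if "r < n" for r
        unfolding b_def using q C G ln1 by (intro mult_nonneg_nonneg) auto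
      show "\<bar>z (real (i * 2 ^ r)) - z (real (Suc i * 2 ^ r))\<bar> \<le> b r" if "r < n" "i < 2 ^ Suc (n - r)" for r i
        using inc[OF that] by (simp only: b_def G_def of_nat_mult of_nat_power of_nat_numeral)
    qed (use jn nk in auto)
    also have "real (j div 2 ^ k * 2 ^ k) = s" by (simp add: s_def i_def)
    also have "(\<Sum>r<k. b r) \<le> (\<Sum>r<k. (C * sqrt 288 * G * l) * (real (n - r) * q ^ (n - r)))"
    proof (rule sum_mono)
      fix r assume "r \<in> {..<k}"
      then have "1 \<le> real (n - r)" using nk by auto
      then have "sqrt (real (n - r)) \<le> real (n - r)"
        using self_le_power[of "real (n - r)" 2] by (intro real_le_lsqrt) auto
      then have "(C * sqrt 288 * G * l * q ^ (n - r)) * sqrt (real (n - r)) \<le> (C * sqrt 288 * G * l * q ^ (n - r)) * real (n - r)"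
        using q C G l by (intro mult_left_mono) auto
      then show "b r \<le> (C * sqrt 288 * G * l) * (real (n - r) * q ^ (n - r))"
        by (simp add: b_def l_def real_sqrt_mult mult_ac)
    qed
    also have "\<dots> = (2 * C * sqrt 288 * (\<Sum>r<k. real (n - r) * q ^ (n - r))) * (G / 2 * l)"
      by (simp flip: sum_distrib_left)
    also have "\<dots> \<le> \<delta> * (G / 2 * l)"
      using m(1) G l unfolding k_def by (intro mult_right_mono) auto
    also have "\<dots> \<le> \<delta> * (S * l)"
      using GS \<delta> l by (intro mult_left_mono mult_right_mono) auto
    finally show ?thesis by (simp add: mult.assoc)
  qed
  have step2: "\<bar>z t - z (real j)\<bar> \<le> \<delta> * S * l"
  proof -
    have "ln (real j) \<le> ln (2 ^ Suc n)"
    proof (subst ln_le_cancel_iff)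
      have "real j \<le> real (2 ^ Suc n)" using jn by (simp only: of_nat_le_iff)
      then show "real j \<le> 2 ^ Suc n" by simp
      have "0 < j" using jn(1) by (rule less_le_trans[rotated]) simp
      then show "0 < real j" by simp
    qed simp
    also have "\<dots> = real (Suc n) * ln 2" by (simp only: ln_realpow zero_less_numeral)
    also have "\<dots> \<le> real (Suc n) * 1" using ln_2_less_1 by (intro mult_left_mono) auto
    finally have "1 + ln (real j) \<le> real n + 2" by simp
    then have "L * sqrt (288 * (1 + ln (real j))) \<le> L * sqrt (288 * (real n + 2))"
      using L by (intro mult_left_mono real_sqrt_le_mono) auto
    also have "\<dots> \<le> \<delta> / 2 * G" using L by (simp add: G_def)
    also have "\<dots> \<le> \<delta> * S * 1" using mult_left_mono[OF GS, of "\<delta> / 2"] \<delta> by simp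
    also have "\<dots> \<le> \<delta> * S * l" using l \<delta> S by (intro mult_left_mono) auto
    finally show ?thesis using osc[OF jn(1) conjI[OF j]] by simp
  qed
  have step3: "z s \<le> (1 + \<delta>) * S * l"
  proof -
    have "z s \<le> S * (sqrt (1 + \<delta>) * l)"
      using margin[OF i] by (simp add: s_def k_def S_def l_def real_sqrt_mult)
    also have "sqrt (1 + \<delta>) \<le> 1 + \<delta>"
      using \<delta> by (intro real_le_lsqrt) (auto simp: power2_eq_square algebra_simps)
    then have "S * (sqrt (1 + \<delta>) * l) \<le> S * ((1 + \<delta>) * l)"
      using S l by (intro mult_left_mono mult_right_mono) auto
    finally show ?thesis by (simp add: mult_ac)
  qed
  have zt: "z t \<le> (1 + 3 * \<delta>) * (S * l)"
    using step1 step2 step3 by (simp add: algebra_simps abs_le_iff)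
  have ut: "(1 - \<delta>) * S \<le> sqrt (U t)"
  proof -
    have st: "s \<le> real j" "real j + 1 \<le> s + 2 ^ k"
    proof -
      have "j mod 2 ^ k < 2 ^ k" by simp
      then have "i * 2 ^ k \<le> j" "j + 1 \<le> i * 2 ^ k + 2 ^ k"
        using div_mult_mod_eq[of j "2 ^ k"] unfolding i_def by linarith+
      then have "real (i * 2 ^ k) \<le> real j" "real (j + 1) \<le> real (i * 2 ^ k + 2 ^ k)"
        by (simp_all only: of_nat_le_iff)
      then show "s \<le> real j" "real j + 1 \<le> s + 2 ^ k" by (simp_all add: s_def)
    qed
    have "\<bar>sqrt (U s) - sqrt (U t)\<bar> \<le> \<phi> \<bar>t - s\<bar>" using s0 t1 by (intro sig) auto
    also have "\<dots> \<le> \<phi> (2 ^ k)" using st j by (intro mono_onD[OF mono]) auto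
    also have "\<dots> \<le> C * q ^ m * G" using dom by (simp add: k_def G_def mult_ac)
    also have "\<dots> \<le> \<delta> / 2 * (2 * S)"
    proof (intro mult_mono GS)
      have "1 \<le> sqrt (288::real)" by simp
      then have "(2 * C * q ^ m) * 1 \<le> (2 * C * q ^ m) * sqrt 288"
        using q C by (intro mult_left_mono) auto
      with m(2) show "C * q ^ m \<le> \<delta> / 2" by (simp add: mult_ac)
    qed (use \<delta> G in auto)
    finally show ?thesis by (simp add: S_def algebra_simps abs_le_iff)
  qed
  define w where "w = (S * l)\<^sup>2"
  have w: "0 < w" using S l by (simp add: w_def)
  have "z t \<le> 0 \<or> (z t)\<^sup>2 \<le> (1 + 3 * \<delta>)\<^sup>2 * w"
  proof (cases "z t \<le> 0")
    case False
    then have "(z t)\<^sup>2 \<le> ((1 + 3 * \<delta>) * (S * l))\<^sup>2" using zt by (intro power_mono) auto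
    then show ?thesis by (simp add: w_def power_mult_distrib)
  qed simp
  moreover have "(1 - \<delta>) ^ 3 * w \<le> U t * ln (ln t)"
  proof -
    have "((1 - \<delta>) * S)\<^sup>2 \<le> (sqrt (U t))\<^sup>2" using ut \<delta> S by (intro power_mono) auto
    then have u: "((1 - \<delta>) * S)\<^sup>2 \<le> U t" using U[of t] t1 by simp
    have "real n * ln 2 = ln (2 ^ n)" by (simp add: ln_realpow)
    also have "\<dots> \<le> ln t" using t by (subst ln_le_cancel_iff) (auto intro: less_le_trans[of 0 "2 ^ n"])
    finally have lt: "real n * ln 2 \<le> ln t" .
    have "0 < real n * ln 2" using n by simp
    then have "ln (real n * ln 2) \<le> ln (ln t)" using lt by (subst ln_le_cancel_iff) auto
    with lnln have v: "(1 - \<delta>) * ln (real n) \<le> ln (ln t)" by simp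
    have "((1 - \<delta>) * S)\<^sup>2 * ((1 - \<delta>) * ln (real n)) \<le> U t * ln (ln t)"
      using u v ln1 \<delta> U[of t] t1 by (intro mult_mono) auto
    then show ?thesis
      unfolding w_def l(2)[symmetric] by (simp add: power_mult_distrib power2_eq_square power3_eq_cube mult_ac)
  qed
  ultimately show ?thesis using w by blast
qed

theorem theorem1p5:
  fixes M :: "'a measure"
    and \<alpha> \<rho> :: real
    and X :: "real \<Rightarrow> 'a \<Rightarrow> real"
    and u :: "real \<Rightarrow> real \<Rightarrow> real"
    and \<phi> :: "real \<Rightarrow> real"
  assumes "prob_space M"
    and "0 < \<alpha>"
    and "permanental_process M \<alpha> {0..} u X"
    and "AE \<omega> in M. continuous_on {0..} (\<lambda>t. X t \<omega>)"
    and "\<And>\<delta>. 0 < \<delta> \<Longrightarrow> 0 < (SUP t\<in>{0..\<delta>}. ereal (u t t))"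
    and "mono_on {0..} \<phi>"
    and "\<And>s t. 0 \<le> s \<Longrightarrow> 0 \<le> t \<Longrightarrow> sigma_fun u s t \<le> \<phi> \<bar>t - s\<bar>"
    and "set_integrable lborel {0<..<1/2} (\<lambda>x. \<phi> x / (x * sqrt (ln (1 / x))))"
    and "0 < \<rho>"
    and "regularly_varying (\<lambda>t. u t t) \<rho>"
    and "(\<lambda>t. (\<phi> t)\<^sup>2) \<in> O[at_top](\<lambda>t. u t t)"
  shows "AE \<omega> in M. Limsup at_top (\<lambda>t. ereal (X t \<omega> / (u t t * ln (ln t)))) \<le> 1"
proof -
  interpret prob_space M by fact
  note ps = \<open>prob_space M\<close> and perm = assms(3) and cont = assms(4) and mono = assms(6) and sigma = assms(7)
  define U where "U t = u t t" for t
  define Z where "Z t \<omega> = sqrt (X t \<omega>)" for t \<omega>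
  have U0: "0 \<le> U t" if "0 \<le> t" for t
    using permanental_margin(3)[OF ps perm, of t] that by (simp add: U_def)
  have sqrtU: "\<bar>sqrt (U s) - sqrt (U t)\<bar> \<le> \<phi> \<bar>t - s\<bar>" if "0 \<le> s" "0 \<le> t" for s t
    unfolding U_def using U0[of s] U0[of t] that permanental_pair(1)[OF ps perm, of s t]
    by (intro order_trans[OF sqrt_diag_le_sigma_fun sigma]) (auto simp: U_def)
  have \<phi>0: "0 \<le> \<phi> h" if "0 \<le> h" for h
    using sqrtU[of 0 h] that by (auto intro: order_trans[OF abs_ge_zero])
  interpret subgaussian_increments M Z \<phi> "2 * increment_const \<alpha>"
  proof
    show "Z t \<in> borel_measurable M" if "0 \<le> t" for t
      using permanental_margin(1)[OF ps perm, of t] that unfolding Z_def by simp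
    show "prob {\<omega> \<in> space M. v * x < \<bar>Z s \<omega> - Z t \<omega>\<bar>} \<le> 2 * increment_const \<alpha> * exp (- (x\<^sup>2 / 72))"
      if "0 \<le> s" "0 \<le> t" "0 < v" "\<phi> \<bar>t - s\<bar> \<le> v" "0 \<le> x" for s t v x
      unfolding Z_def using that sigma[of s t]
      by (intro increment_tail[OF ps \<open>0 < \<alpha>\<close> perm]) auto
  qed
  have rv: "regularly_varying U \<rho>" using assms(10) by (simp add: U_def[abs_def])
  have big: "(\<lambda>t. (\<phi> t)\<^sup>2) \<in> O[at_top](U)" using assms(11) by (simp add: U_def[abs_def])
  obtain q C N where q: "0 < q" "q < (1::real)" and C: "0 < C"
    and Upos: "\<And>n. N \<le> n \<Longrightarrow> 0 < U (2 ^ n)"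
    and dom: "\<And>n r. N \<le> n \<Longrightarrow> r \<le> n \<Longrightarrow> \<phi> (2 ^ r) \<le> C * sqrt (U (2 ^ n)) * q ^ (n - r)"
    and slow: "(\<lambda>n. real n / U (2 ^ n)) \<longlonglongrightarrow> 0"
    by (rule regularly_varying_dominates_dyadic[OF \<open>0 < \<rho>\<close> rv big mono]) blast
  have dyadic: "AE \<omega> in M. \<forall>\<^sub>F n in sequentially. \<forall>r<n. \<forall>i<2 ^ Suc (n - r).
    \<bar>Z (real i * 2 ^ r) \<omega> - Z (real (Suc i) * 2 ^ r) \<omega>\<bar>
      \<le> C * sqrt (U (2 ^ n)) * q ^ (n - r) * sqrt (288 * real (n - r) * ln (real n))"
    using Upos C q dom by (intro AE_dyadic_increments[of N]) auto
  \<comment> \<open>The summand \<open>(1/2) ^ k\<close> keeps the scales positive if \<open>\<phi>\<close> vanishes near \<open>0\<close>.\<close>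
  define v where "v k = \<phi> (2 / 2 ^ 2 ^ k) + (1/2) ^ k" for k :: nat
  define L where "L = (\<Sum>k. sqrt (2 ^ k) * v k)"
  have v: "0 < v k" "\<phi> (2 / 2 ^ 2 ^ k) \<le> v k" for k
    using \<phi>0[of "2 / 2 ^ 2 ^ k"] by (auto simp: v_def add_nonneg_pos)
  have sum_v: "summable (\<lambda>k. sqrt (2 ^ k) * v k)"
  proof -
    have "summable (\<lambda>k. (sqrt 2 / 2) ^ k)"
      using real_sqrt_less_mono[of 2 4] by (intro summable_geometric) auto
    then have "summable (\<lambda>k. sqrt (2 ^ k) * \<phi> (2 / 2 ^ 2 ^ k) + (sqrt 2 / 2) ^ k)"
      by (intro summable_add entropy_integral_imp_summable[OF mono \<phi>0 assms(8)])
    then show ?thesis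
      by (simp add: v_def distrib_left real_sqrt_power power_divide)
  qed
  have L0: "0 \<le> L"
    unfolding L_def using v(1) by (intro suminf_nonneg sum_v) (auto intro: less_imp_le)
  have "AE \<omega> in M. continuous_on {0..} (\<lambda>t. Z t \<omega>)"
    using cont unfolding Z_def by eventually_elim (intro continuous_intros)
  from AE_local_oscillation[OF v mono sum_v this]
  have osc: "AE \<omega> in M. \<forall>\<^sub>F j in sequentially. \<forall>t. real j \<le> t \<and> t < real j + 1 \<longrightarrow>
    \<bar>Z t \<omega> - Z (real j) \<omega>\<bar> \<le> L * sqrt (288 * (1 + ln (real j)))"
    by (simp only: L_def)
  have bound: "AE \<omega> in M. \<forall>\<^sub>F t in at_top. X t \<omega> / (U t * ln (ln t)) \<le> (1 + 3 * \<delta>)\<^sup>2 / (1 - \<delta>) ^ 3"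
    if \<delta>: "0 < \<delta>" "\<delta> < 1" for \<delta>
  proof -
    obtain m where m: "\<And>n. m \<le> n \<Longrightarrow> 2 * C * sqrt 288 * (\<Sum>r<n - m. real (n - r) * q ^ (n - r)) \<le> \<delta>"
        "2 * C * sqrt 288 * q ^ m \<le> \<delta>"
      using summable_times_power_tail[of q "2 * C * sqrt 288" \<delta>] q C \<delta> by auto
    from rv have "\<forall>\<^sub>F t in at_top. 0 < u t t"
      by (auto simp: regularly_varying_def U_def eventually_at_top_linorder)
    from AE_grid_margins[OF ps perm this \<delta>(1), of m]
    have grid: "AE \<omega> in M. \<forall>\<^sub>F n in sequentially. \<forall>i\<in>{2 ^ m..<2 ^ Suc m}.
        X (real i * 2 ^ (n - m)) \<omega> \<le> U (real i * 2 ^ (n - m)) * ((1 + \<delta>) * ln (real n))"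
      by (simp only: U_def)
    \<comment> \<open>A block start is a multiple \<open>c * 2 ^ n\<close> with \<open>c \<ge> 1\<close> from a finite set independent of \<open>n\<close>.\<close>
    have comp: "\<forall>\<^sub>F n in sequentially. \<forall>i\<in>{2 ^ m..<2 ^ Suc m}. U (2 ^ n) / 4 < U (real i * 2 ^ (n - m))"
    proof (intro eventually_ball_finite ballI)
      fix i :: nat assume i: "i \<in> {2 ^ m..<2 ^ Suc m}"
      define c where "c = real i / 2 ^ m"
      have "real (2 ^ m) \<le> real i" using i by (intro of_nat_mono) simp
      then have c: "1 \<le> c" by (simp add: c_def)
      have "((\<lambda>t. U (c * t) / U t) \<longlongrightarrow> c powr \<rho>) at_top"
        using rv c by (simp add: regularly_varying_def)
      moreover have "1 / 4 < c powr \<rho>"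
        using ge_one_powr_ge_zero[OF c, of \<rho>] \<open>0 < \<rho>\<close> by simp
      ultimately have "\<forall>\<^sub>F t in at_top. 1 / 4 < U (c * t) / U t"
        by (rule order_tendstoD)
      then have "\<forall>\<^sub>F n in sequentially. 1 / 4 < U (c * 2 ^ n) / U (2 ^ n)"
        by (rule eventually_compose_filterlim[OF _ filterlim_power2_at_top])
      moreover have "\<forall>\<^sub>F n in sequentially. max N m \<le> n" by (rule eventually_ge_at_top)
      ultimately show "\<forall>\<^sub>F n in sequentially. U (2 ^ n) / 4 < U (real i * 2 ^ (n - m))"
      proof eventually_elim
        case (elim n)
        then have "c * 2 ^ n = real i * 2 ^ (n - m)" by (simp add: c_def power_diff)
        with elim Upos[of n] show ?case by (simp add: field_simps)
      qed
    qed simp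
    have osc_small: "\<forall>\<^sub>F n in sequentially. L * sqrt (288 * (real n + 2)) \<le> \<delta> / 2 * sqrt (U (2 ^ n))"
    proof -
      define \<kappa> where "\<kappa> = (\<delta> / 2)\<^sup>2 / (864 * (L\<^sup>2 + 1))"
      have L1: "0 < L\<^sup>2 + 1" using zero_le_power2[of L] by linarith
      have "0 < \<kappa>" using \<delta> L1 by (simp add: \<kappa>_def)
      with slow have "\<forall>\<^sub>F n in sequentially. real n / U (2 ^ n) < \<kappa>" by (rule order_tendstoD)
      moreover have "\<forall>\<^sub>F n in sequentially. max N 1 \<le> n" by (rule eventually_ge_at_top)
      ultimately show ?thesis
      proof eventually_elim
        case (elim n)
        then have n: "0 < U (2 ^ n)" "1 \<le> n" using Upos[of n] by auto
        have "real n * (864 * (L\<^sup>2 + 1)) \<le> (\<delta> / 2)\<^sup>2 * U (2 ^ n)"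
          using elim n L1 by (simp add: \<kappa>_def divide_less_eq less_divide_eq mult_ac)
        moreover have "L\<^sup>2 * (288 * (real n + 2)) \<le> (L\<^sup>2 + 1) * (288 * (3 * real n))"
          using n by (intro mult_mono) auto
        ultimately have "L\<^sup>2 * (288 * (real n + 2)) \<le> (\<delta> / 2)\<^sup>2 * U (2 ^ n)" by (simp add: mult_ac)
        then have "sqrt (L\<^sup>2 * (288 * (real n + 2))) \<le> sqrt ((\<delta> / 2)\<^sup>2 * U (2 ^ n))"
          by (rule real_sqrt_le_mono)
        then show ?case using L0 \<delta> by (simp add: real_sqrt_mult)
      qed
    qed
    have lnln: "\<forall>\<^sub>F n in sequentially. (1 - \<delta>) * ln (real n) \<le> ln (real n * ln 2)"
    proof -
      have "filterlim (\<lambda>n. ln (real n)) at_top sequentially"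
        by (rule filterlim_compose[OF ln_at_top filterlim_real_sequentially])
      then have "\<forall>\<^sub>F n in sequentially. - ln (ln 2) / \<delta> \<le> ln (real n)"
        by (simp add: filterlim_at_top)
      then show ?thesis using eventually_gt_at_top[of 0]
      proof eventually_elim
        case (elim n)
        then have "ln (real n * ln 2) = ln (real n) + ln (ln 2)" by (simp add: ln_mult)
        with elim \<delta> show ?case by (simp add: field_simps)
      qed
    qed
    from dyadic osc grid show ?thesis
    proof eventually_elim
      case (elim \<omega>)
      from elim(2) obtain J where J: "\<And>j t. J \<le> j \<Longrightarrow> real j \<le> t \<and> t < real j + 1 \<Longrightarrow>
        \<bar>Z t \<omega> - Z (real j) \<omega>\<bar> \<le> L * sqrt (288 * (1 + ln (real j)))"
        by (auto simp: eventually_sequentially)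
      have "\<forall>\<^sub>F n in sequentially. max (max N m) (max 3 J) \<le> n" by (rule eventually_ge_at_top)
      with elim(1,3) comp osc_small lnln
      have "\<forall>\<^sub>F n in sequentially. \<forall>t. 2 ^ n \<le> t \<and> t < 2 ^ Suc n \<longrightarrow>
        X t \<omega> / (U t * ln (ln t)) \<le> (1 + 3 * \<delta>)\<^sup>2 / (1 - \<delta>) ^ 3"
      proof eventually_elim
        case (elim n)
        have n: "N \<le> n" "m \<le> n" "3 \<le> n" "J \<le> n" using elim(6) by simp_all
        show ?case
        proof (intro allI impI)
          fix t :: real assume t: "2 ^ n \<le> t \<and> t < 2 ^ Suc n"
          have "\<exists>w>0. (Z t \<omega> \<le> 0 \<or> (Z t \<omega>)\<^sup>2 \<le> (1 + 3 * \<delta>)\<^sup>2 * w) \<and> (1 - \<delta>) ^ 3 * w \<le> U t * ln (ln t)"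
          proof (rule dyadic_block_estimate[where z = "\<lambda>t. Z t \<omega>" and U = U and \<phi> = \<phi> and m = m and n = n
                and q = q and C = C and L = L])
            show "\<phi> (2 ^ (n - m)) \<le> C * sqrt (U (2 ^ n)) * q ^ m"
              using dom[of n "n - m"] n by simp
            show "\<bar>Z (real i * 2 ^ r) \<omega> - Z (real (Suc i) * 2 ^ r) \<omega>\<bar>
              \<le> C * sqrt (U (2 ^ n)) * q ^ (n - r) * sqrt (288 * real (n - r) * ln (real n))"
              if "r < n" "i < 2 ^ Suc (n - r)" for r i
              using elim(1) that by blast
            show "\<bar>Z t \<omega> - Z (real j) \<omega>\<bar> \<le> L * sqrt (288 * (1 + ln (real j)))"
              if "2 ^ n \<le> j" "real j \<le> t \<and> t < real j + 1" for j t
            proof (rule J[OF _ that(2)])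
              show "J \<le> j" using n(4) less_exp[of n] that(1) by linarith
            qed
            show "Z (real i * 2 ^ (n - m)) \<omega> \<le> sqrt (U (real i * 2 ^ (n - m)) * ((1 + \<delta>) * ln (real n)))"
              if "i \<in> {2 ^ m..<2 ^ Suc m}" for i
              unfolding Z_def using elim(2) that by (intro real_sqrt_le_mono) blast
            show "U (2 ^ n) / 4 < U (real i * 2 ^ (n - m))" if "i \<in> {2 ^ m..<2 ^ Suc m}" for i
              using elim(3) that by blast
          qed (use \<delta> q C U0 sqrtU mono n Upos[OF n(1)] L0 elim(4,5) m(1)[OF n(2)] m(2) t in auto)
          then obtain w where w: "0 < w" "Z t \<omega> \<le> 0 \<or> (Z t \<omega>)\<^sup>2 \<le> (1 + 3 * \<delta>)\<^sup>2 * w"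
            "(1 - \<delta>) ^ 3 * w \<le> U t * ln (ln t)" by blast
          have "X t \<omega> \<le> (1 + 3 * \<delta>)\<^sup>2 * w"
          proof (cases "Z t \<omega> \<le> 0")
            case True
            then have "X t \<omega> \<le> 0" by (simp add: Z_def)
            also have "0 \<le> (1 + 3 * \<delta>)\<^sup>2 * w" using w by simp
            finally show ?thesis .
          next
            case False
            then have "X t \<omega> = (Z t \<omega>)\<^sup>2" by (simp add: Z_def)
            with w False show ?thesis by simp
          qed
          then have "X t \<omega> / (U t * ln (ln t)) \<le> ((1 + 3 * \<delta>)\<^sup>2 * w) / ((1 - \<delta>) ^ 3 * w)"
            using w \<delta> by (intro frac_le) auto
          then show "X t \<omega> / (U t * ln (ln t)) \<le> (1 + 3 * \<delta>)\<^sup>2 / (1 - \<delta>) ^ 3"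
            using w by simp
        qed
      qed
      then obtain n0 where n0: "\<And>n t. n0 \<le> n \<Longrightarrow> 2 ^ n \<le> t \<Longrightarrow> t < 2 ^ Suc n \<Longrightarrow>
        X t \<omega> / (U t * ln (ln t)) \<le> (1 + 3 * \<delta>)\<^sup>2 / (1 - \<delta>) ^ 3"
        by (auto simp: eventually_sequentially)
      show ?case
      proof (rule eventually_at_top_linorderI[of "2 ^ n0"])
        fix t :: real assume t: "2 ^ n0 \<le> t"
        \<comment> \<open>The dyadic block of \<open>t\<close>.\<close>
        define n where "n = (LEAST n. t < 2 ^ Suc n)"
        obtain k where "t < 2 ^ k" using real_arch_pow[of 2 t] by auto
        then have "t < 2 ^ Suc k" by (rule less_le_trans) simp
        then have n: "t < 2 ^ Suc n" unfolding n_def by (rule LeastI)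
        have "n0 \<le> n"
        proof (rule ccontr)
          assume "\<not> n0 \<le> n"
          then have "(2::real) ^ Suc n \<le> 2 ^ n0" by (intro power_increasing) auto
          with n t show False by simp
        qed
        have "2 ^ n \<le> t"
        proof (cases "n = n0")
          case False
          with \<open>n0 \<le> n\<close> obtain n' where n': "n = Suc n'" by (cases n) auto
          then have "\<not> t < 2 ^ Suc n'"
            using not_less_Least[of n' "\<lambda>n. t < 2 ^ Suc n"] by (simp add: n_def)
          then show ?thesis by (simp add: n')
        qed (use t in simp)
        from n0[OF \<open>n0 \<le> n\<close> this n]
        show "X t \<omega> / (U t * ln (ln t)) \<le> (1 + 3 * \<delta>)\<^sup>2 / (1 - \<delta>) ^ 3" .
      qed
    qed
  qed
  define \<delta> where "\<delta> j = inverse (real (Suc (Suc j)))" for j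
  define B where "B j = (1 + 3 * \<delta> j)\<^sup>2 / (1 - \<delta> j) ^ 3" for j
  have \<delta>: "0 < \<delta> j" "\<delta> j < 1" for j by (auto simp: \<delta>_def field_simps)
  have "\<delta> \<longlonglongrightarrow> 0"
    unfolding \<delta>_def by (rule LIMSEQ_Suc[OF LIMSEQ_inverse_real_of_nat])
  then have "B \<longlonglongrightarrow> (1 + 3 * 0)\<^sup>2 / (1 - 0) ^ 3"
    unfolding B_def by (intro tendsto_intros) auto
  then have B: "(\<lambda>j. ereal (B j)) \<longlonglongrightarrow> 1" by (simp add: one_ereal_def)
  have "AE \<omega> in M. \<forall>j. \<forall>\<^sub>F t in at_top. X t \<omega> / (U t * ln (ln t)) \<le> B j"
    unfolding AE_all_countable B_def using bound[OF \<delta>] by blast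
  then show ?thesis
  proof eventually_elim
    case (elim \<omega>)
    have "Limsup at_top (\<lambda>t. ereal (X t \<omega> / (u t t * ln (ln t)))) \<le> ereal (B j)" for j
      using elim[rule_format, of j] by (intro Limsup_bounded) (simp add: U_def)
    then show ?case by (intro LIMSEQ_le_const[OF B]) auto
  qed
qed

end
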